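(* Let $n\ge 1$ and let $\tilde A,\tilde B$ be two (not necessarily maximal) Abelian subgroups of $\widetilde{\mathcal P}_n$. Then $\tilde A$ and $\tilde B$ are complementary if and only if $\tilde A\cap C(\tilde B)=\{\mathbb 1\}$ and $\tilde B\cap C(\tilde A)=\{\mathbb 1\}$.
   Context: $\widetilde{\mathcal P}_n=\{\mathbb 1,X,Y,Z\}^{\otimes n}$ is the set of the $4^n$ Hermitian $n$-qubit Pauli operators on $\mathbb C^{2^n}$, and $\mathcal P_n$ is the Pauli group they generate (phases $\pm1,\pm i$). An Abelian subgroup $A$ of $\widetilde{\mathcal P}_n$ means a commutative subgroup $A<\mathcal P_n$ with $A\subset\pm\widetilde{\mathcal P}_n$ and $-\mathbb 1\notin A$; then $A\cong\mathbb Z_2^m$ for some $0\le m\le n$, called its dimension. Signs are disregarded: $A$ is identified with the set of $P\in\widetilde{\mathcal P}_n$ such that $P\in A$ or $-P\in A$, and intersections, inclusions and equalities are understood in this sense. The commutant is $C(A)=\{P\in\widetilde{\mathcal P}_n\mid [P,Q]=0\ \forall Q\in A\}$. Choosing independent generators $P_1,\dots,P_m$ of $A$, set $\Pi^A_x=\prod_{k=1}^m\frac{\mathbb 1+(-1)^{x_k}P_k}{2}$ and $p^A_\rho(x)=\mathrm{tr}[\Pi^A_x\rho]$ for $x\in\mathbb Z_2^m$ and $\rho$ a density operator on $\mathbb C^{2^n}$. The state $\rho$ is a state of maximal information (minimal uncertainty) in $A$ if $p^A_\rho(x)=\delta_{xx_0}$ for some $x_0$, and is unbiased (maximally uncertain)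 in $A$ if $p^A_\rho(x)=2^{-m}$ for all $x$. (These notions do not depend on the choice of generators or signs.) Two Abelian subgroups $A,B$ are complementary if every state of maximal information in $A$ is unbiased in $B$ and every state of maximal information in $B$ is unbiased in $A$. *)

theory Defs
  imports
    "Jordan_Normal_Form.Matrix"
    "Jordan_Normal_Form.Schur_Decomposition"
    "HOL-Algebra.Generated_Groups"
begin

section \<open>Pauli operators\<close>

definition pauli_X :: "complex mat" where
  "pauli_X = mat_of_rows_list 2 [[0, 1], [1, 0]]"

definition pauli_Y :: "complex mat" where
  "pauli_Y = mat_of_rows_list 2 [[0, - \<i>], [\<i>, 0]]"

definition pauli_Z :: "complex mat" where
  "pauli_Z = mat_of_rows_list 2 [[1, 0], [0, - 1]]"

definition single_paulis :: "complex mat set" where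
  "single_paulis = {1\<^sub>m 2, pauli_X, pauli_Y, pauli_Z}"

definition kron :: "complex mat \<Rightarrow> complex mat \<Rightarrow> complex mat" where
  "kron A B = mat (dim_row A * dim_row B) (dim_col A * dim_col B)
     (\<lambda>(i, j). A $$ (i div dim_row B, j div dim_col B) * B $$ (i mod dim_row B, j mod dim_col B))"

definition tensor :: "complex mat list \<Rightarrow> complex mat" where
  "tensor Ss = foldr kron Ss (1\<^sub>m 1)"

definition pauli_ops :: "nat \<Rightarrow> complex mat set" where
  "pauli_ops n = {tensor Ss | Ss. length Ss = n \<and> set Ss \<subseteq> single_paulis}"

definition phases :: "complex set" where
  "phases = {1, - 1, \<i>, - \<i>}"

definition pauli_group :: "nat \<Rightarrow> complex mat monoid" where
  "pauli_group n =
     \<lparr>carrier = {c \<cdot>\<^sub>m P | c P. c \<in> phases \<and> P \<in> pauli_ops n}, monoid.mult = (*), one = 1\<^sub>m (2 ^ n)\<rparr>"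

section \<open>Abelian subgroups\<close>

definition abelian_pauli_subgroup :: "nat \<Rightarrow> complex mat set \<Rightarrow> bool" where
  "abelian_pauli_subgroup n A \<longleftrightarrow>
     subgroup A (pauli_group n) \<and>
     (\<forall>P\<in>A. \<forall>Q\<in>A. P * Q = Q * P) \<and>
     A \<subseteq> pauli_ops n \<union> uminus ` pauli_ops n \<and>
     - 1\<^sub>m (2 ^ n) \<notin> A"

text \<open>The set of Hermitian Pauli operators that is identified with \<open>A\<close> when signs are disregarded.\<close>

definition unsigned_paulis :: "nat \<Rightarrow> complex mat set \<Rightarrow> complex mat set" where
  "unsigned_paulis n A = {P \<in> pauli_ops n. P \<in> A \<or> - P \<in> A}"

definition commutant :: "nat \<Rightarrow> complex mat set \<Rightarrow> complex mat set" where
  "commutant n A = {P \<in> pauli_ops n. \<forall>Q\<in>A. P * Q = Q * P}"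

definition independent_generators :: "nat \<Rightarrow> complex mat set \<Rightarrow> complex mat list \<Rightarrow> bool" where
  "independent_generators n A Ps \<longleftrightarrow>
     distinct Ps \<and>
     generate (pauli_group n) (set Ps) = A \<and>
     (\<forall>P \<in> set Ps. P \<notin> generate (pauli_group n) (set Ps - {P}))"

text \<open>One choice of independent generators; such a choice exists by
  \<open>independent_generators_exist\<close> below.\<close>

definition generators :: "nat \<Rightarrow> complex mat set \<Rightarrow> complex mat list" where
  "generators n A = (SOME Ps. independent_generators n A Ps)"

definition pauli_dim :: "nat \<Rightarrow> complex mat set \<Rightarrow> nat" where
  "pauli_dim n A = length (generators n A)"

section \<open>States and measurement statistics\<close>

definition mat_trace :: "complex mat \<Rightarrow> complex" where
  "mat_trace M = (\<Sum>i < dim_row M. M $$ (i, i))"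

definition density_operator :: "nat \<Rightarrow> complex mat \<Rightarrow> bool" where
  "density_operator n \<rho> \<longleftrightarrow>
     \<rho> \<in> carrier_mat (2 ^ n) (2 ^ n) \<and>
     mat_adjoint \<rho> = \<rho> \<and>
     (\<forall>v \<in> carrier_vec (2 ^ n). 0 \<le> Re ((\<rho> *\<^sub>v v) \<bullet>c v)) \<and>
     mat_trace \<rho> = 1"

text \<open>The elements of \<open>\<int>\<^sub>2\<^sup>m\<close>, as \<open>{0, 1}\<close>-valued functions on \<open>{..<m}\<close>.\<close>

definition bit_vectors :: "nat \<Rightarrow> (nat \<Rightarrow> nat) set" where
  "bit_vectors m = {..<m} \<rightarrow>\<^sub>E {0, 1}"

definition projector :: "nat \<Rightarrow> complex mat set \<Rightarrow> (nat \<Rightarrow> nat) \<Rightarrow> complex mat" where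
  "projector n A x =
     foldr (\<lambda>k M. ((1 / 2) \<cdot>\<^sub>m (1\<^sub>m (2 ^ n) + (- 1) ^ x k \<cdot>\<^sub>m (generators n A ! k))) * M)
       [0..<pauli_dim n A] (1\<^sub>m (2 ^ n))"

definition outcome_prob ::
  "nat \<Rightarrow> complex mat set \<Rightarrow> complex mat \<Rightarrow> (nat \<Rightarrow> nat) \<Rightarrow> complex" where
  "outcome_prob n A \<rho> x = mat_trace (projector n A x * \<rho>)"

definition maximal_information :: "nat \<Rightarrow> complex mat set \<Rightarrow> complex mat \<Rightarrow> bool" where
  "maximal_information n A \<rho> \<longleftrightarrow>
     (\<exists>x\<^sub>0 \<in> bit_vectors (pauli_dim n A). \<forall>x \<in> bit_vectors (pauli_dim n A).
        outcome_prob n A \<rho> x = (if x = x\<^sub>0 then 1 else 0))"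

definition unbiased :: "nat \<Rightarrow> complex mat set \<Rightarrow> complex mat \<Rightarrow> bool" where
  "unbiased n A \<rho> \<longleftrightarrow>
     (\<forall>x \<in> bit_vectors (pauli_dim n A). outcome_prob n A \<rho> x = 1 / 2 ^ pauli_dim n A)"

definition complementary :: "nat \<Rightarrow> complex mat set \<Rightarrow> complex mat set \<Rightarrow> bool" where
  "complementary n A B \<longleftrightarrow>
     (\<forall>\<rho>. density_operator n \<rho> \<longrightarrow>
        (maximal_information n A \<rho> \<longrightarrow> unbiased n B \<rho>) \<and>
        (maximal_information n B \<rho> \<longrightarrow> unbiased n A \<rho>))"

section \<open>The group structure and existence of independent generators\<close>

lemma kron_carrier:
  assumes "A \<in> carrier_mat a b" "B \<in> carrier_mat c d"
  shows "kron A B \<in> carrier_mat (a * c) (b * d)"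
  using assms by (auto simp: kron_def)

lemma kron_mult:
  assumes A: "A \<in> carrier_mat a a" and B: "B \<in> carrier_mat b b"
    and C: "C \<in> carrier_mat a a" and D: "D \<in> carrier_mat b b"
  shows "kron A B * kron C D = kron (A * C) (B * D)"
proof (rule eq_matI)
  fix i j assume "i < dim_row (kron (A * C) (B * D))" "j < dim_col (kron (A * C) (B * D))"
  then have i: "i < a * b" and j: "j < a * b" using A B C D by (auto simp: kron_def)
  have b: "0 < b" using i by (cases b) auto
  have id: "i div b < a" "j div b < a" "i mod b < b" "j mod b < b"
    using i j b by (auto simp: less_mult_imp_div_less)
  have "(kron A B * kron C D) $$ (i, j) =
      (\<Sum>l<a * b. A $$ (i div b, l div b) * B $$ (i mod b, l mod b) *
         (C $$ (l div b, j div b) * D $$ (l mod b, j mod b)))"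
    using i j A B C D by (simp add: kron_def scalar_prod_def atLeast0LessThan)
  also have "\<dots> = (\<Sum>k<a. \<Sum>l = k * b..<k * b + b. A $$ (i div b, l div b) * B $$ (i mod b, l mod b) *
         (C $$ (l div b, j div b) * D $$ (l mod b, j mod b)))"
    by (rule sum.nat_group[symmetric])
  also have "\<dots> = (\<Sum>k<a. \<Sum>l<b. A $$ (i div b, k) * B $$ (i mod b, l) *
         (C $$ (k, j div b) * D $$ (l, j mod b)))"
  proof (rule sum.cong[OF refl])
    fix k
    show "(\<Sum>l = k * b..<k * b + b. A $$ (i div b, l div b) * B $$ (i mod b, l mod b) *
         (C $$ (l div b, j div b) * D $$ (l mod b, j mod b))) =
       (\<Sum>l<b. A $$ (i div b, k) * B $$ (i mod b, l) * (C $$ (k, j div b) * D $$ (l, j mod b)))"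
    proof (rule sum.reindex_bij_witness[where i = "\<lambda>l. k * b + l" and j = "\<lambda>l. l - k * b"])
      fix l assume l: "l \<in> {k * b..<k * b + b}"
      then obtain r where r: "l = k * b + r" "r < b"
        by (metis add_less_cancel_left atLeastLessThan_iff le_iff_add)
      then have "l div b = k" "l mod b = r" by (auto simp: div_nat_eqI)
      then show "A $$ (i div b, k) * B $$ (i mod b, l - k * b) *
          (C $$ (k, j div b) * D $$ (l - k * b, j mod b)) =
        A $$ (i div b, l div b) * B $$ (i mod b, l mod b) *
          (C $$ (l div b, j div b) * D $$ (l mod b, j mod b))"
        using r by simp
    qed auto
  qed
  also have "\<dots> = (\<Sum>k<a. A $$ (i div b, k) * C $$ (k, j div b)) *
      (\<Sum>l<b. B $$ (i mod b, l) * D $$ (l, j mod b))"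
    by (simp add: sum_product algebra_simps)
  also have "\<dots> = kron (A * C) (B * D) $$ (i, j)"
    using i j id A B C D by (simp add: kron_def scalar_prod_def atLeast0LessThan)
  finally show "(kron A B * kron C D) $$ (i, j) = kron (A * C) (B * D) $$ (i, j)" .
qed (use A B C D in \<open>auto simp: kron_def\<close>)

lemma kron_smult:
  assumes "A \<in> carrier_mat a a" "B \<in> carrier_mat b b"
  shows "kron (c \<cdot>\<^sub>m A) (d \<cdot>\<^sub>m B) = (c * d) \<cdot>\<^sub>m kron A B"
proof (rule eq_matI)
  fix i j assume "i < dim_row ((c * d) \<cdot>\<^sub>m kron A B)" "j < dim_col ((c * d) \<cdot>\<^sub>m kron A B)"
  then have i: "i < a * b" and j: "j < a * b" using assms by (auto simp: kron_def)
  have b: "0 < b" using i by (cases b) auto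
  have id: "i div b < a" "j div b < a" "i mod b < b" "j mod b < b"
    using i j b by (auto simp: less_mult_imp_div_less)
  then show "kron (c \<cdot>\<^sub>m A) (d \<cdot>\<^sub>m B) $$ (i, j) = ((c * d) \<cdot>\<^sub>m kron A B) $$ (i, j)"
    using assms i j by (simp add: kron_def)
qed (use assms in \<open>auto simp: kron_def\<close>)

lemma kron_one: "kron (1\<^sub>m a) (1\<^sub>m b) = 1\<^sub>m (a * b)"
proof (rule eq_matI)
  fix i j assume "i < dim_row (1\<^sub>m (a * b))" "j < dim_col (1\<^sub>m (a * b))"
  then have i: "i < a * b" and j: "j < a * b" by auto
  have b: "0 < b" using i by (cases b) auto
  have id: "i div b < a" "j div b < a" "i mod b < b" "j mod b < b"
    using i j b by (auto simp: less_mult_imp_div_less)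
  have "i = j" if "i div b = j div b" "i mod b = j mod b"
    using that by (metis div_mult_mod_eq)
  then show "kron (1\<^sub>m a) (1\<^sub>m b) $$ (i, j) = 1\<^sub>m (a * b) $$ (i, j)"
    using i j id by (auto simp: kron_def)
qed (auto simp: kron_def)

lemma single_paulis_carrier: "S \<in> single_paulis \<Longrightarrow> S \<in> carrier_mat 2 2"
  by (auto simp: single_paulis_def pauli_X_def pauli_Y_def pauli_Z_def mat_of_rows_list_def)

lemmas single_pauli_defs =
  single_paulis_def phases_def pauli_X_def pauli_Y_def pauli_Z_def mat_of_rows_list_def

lemma eq_mat2I:
  fixes A B :: "complex mat"
  assumes "A \<in> carrier_mat 2 2" "B \<in> carrier_mat 2 2"
    "A $$ (0, 0) = B $$ (0, 0)" "A $$ (0, 1) = B $$ (0, 1)"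
    "A $$ (1, 0) = B $$ (1, 0)" "A $$ (1, 1) = B $$ (1, 1)"
  shows "A = B"
  using assms by (intro eq_matI) (auto simp: less_2_cases_iff)

lemma index_mult_mat2:
  fixes A B :: "complex mat"
  assumes "A \<in> carrier_mat 2 2" "B \<in> carrier_mat 2 2" "i < 2" "j < 2"
  shows "(A * B) $$ (i, j) = A $$ (i, 0) * B $$ (0, j) + A $$ (i, 1) * B $$ (1, j)"
  using assms by (simp add: scalar_prod_def eval_nat_numeral)

lemma pauli_entries:
  "1\<^sub>m 2 $$ (0, 0) = (1 :: complex)" "1\<^sub>m 2 $$ (0, 1) = (0 :: complex)"
  "1\<^sub>m 2 $$ (1, 0) = (0 :: complex)" "1\<^sub>m 2 $$ (1, 1) = (1 :: complex)"
  "pauli_X $$ (0, 0) = 0" "pauli_X $$ (0, 1) = 1" "pauli_X $$ (1, 0) = 1" "pauli_X $$ (1, 1) = 0"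
  "pauli_Y $$ (0, 0) = 0" "pauli_Y $$ (0, 1) = - \<i>" "pauli_Y $$ (1, 0) = \<i>" "pauli_Y $$ (1, 1) = 0"
  "pauli_Z $$ (0, 0) = 1" "pauli_Z $$ (0, 1) = 0" "pauli_Z $$ (1, 0) = 0" "pauli_Z $$ (1, 1) = - 1"
  by (auto simp: pauli_X_def pauli_Y_def pauli_Z_def mat_of_rows_list_def)

lemma pauli_carriers:
  "(1\<^sub>m 2 :: complex mat) \<in> carrier_mat 2 2"
  "pauli_X \<in> carrier_mat 2 2" "pauli_Y \<in> carrier_mat 2 2" "pauli_Z \<in> carrier_mat 2 2"
  by (auto simp: pauli_X_def pauli_Y_def pauli_Z_def mat_of_rows_list_def)

lemma single_pauli_products:
  "pauli_X * pauli_X = 1\<^sub>m 2" "pauli_Y * pauli_Y = 1\<^sub>m 2" "pauli_Z * pauli_Z = 1\<^sub>m 2"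
  "pauli_X * pauli_Y = \<i> \<cdot>\<^sub>m pauli_Z" "pauli_Y * pauli_X = (- \<i>) \<cdot>\<^sub>m pauli_Z"
  "pauli_Y * pauli_Z = \<i> \<cdot>\<^sub>m pauli_X" "pauli_Z * pauli_Y = (- \<i>) \<cdot>\<^sub>m pauli_X"
  "pauli_Z * pauli_X = \<i> \<cdot>\<^sub>m pauli_Y" "pauli_X * pauli_Z = (- \<i>) \<cdot>\<^sub>m pauli_Y"
  by (rule eq_mat2I;
      use pauli_carriers in \<open>simp add: index_mult_mat2 pauli_entries del: index_mult_mat(1) One_nat_def\<close>)+

lemma smult_one: "1 \<cdot>\<^sub>m A = (A :: complex mat)"
  by (intro eq_matI) auto

lemma single_pauli_mult:
  assumes "S \<in> single_paulis" "T \<in> single_paulis"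
  obtains c U where "c \<in> phases" "U \<in> single_paulis" "S * T = c \<cdot>\<^sub>m U"
proof -
  have phase: "\<exists>c U. c \<in> phases \<and> U \<in> single_paulis \<and> M = c \<cdot>\<^sub>m U"
    if "M = c \<cdot>\<^sub>m U" "c \<in> phases" "U \<in> single_paulis" for M c U
    using that by blast
  have plain: "\<exists>c U. c \<in> phases \<and> U \<in> single_paulis \<and> M = c \<cdot>\<^sub>m U"
    if "M \<in> single_paulis" for M
    by (rule phase[OF smult_one[symmetric] _ that]) (simp add: phases_def)
  have c: "1\<^sub>m 2 \<in> single_paulis" "pauli_X \<in> single_paulis" "pauli_Y \<in> single_paulis"
    "pauli_Z \<in> single_paulis" "\<i> \<in> phases" "- \<i> \<in> phases"
    by (simp_all add: single_paulis_def phases_def)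
  note one = left_mult_one_mat[OF single_paulis_carrier] right_mult_one_mat[OF single_paulis_carrier]
  consider "S = 1\<^sub>m 2" | "T = 1\<^sub>m 2" | "S = T"
    | "S = pauli_X" "T = pauli_Y" | "S = pauli_Y" "T = pauli_X"
    | "S = pauli_Y" "T = pauli_Z" | "S = pauli_Z" "T = pauli_Y"
    | "S = pauli_Z" "T = pauli_X" | "S = pauli_X" "T = pauli_Z"
    using assms by (auto simp: single_paulis_def)
  then have "\<exists>c U. c \<in> phases \<and> U \<in> single_paulis \<and> S * T = c \<cdot>\<^sub>m U"
  proof cases
    case 1
    then show ?thesis using plain[OF assms(2)] one(1)[OF assms(2)] by simp
  next
    case 2
    then show ?thesis using plain[OF assms(1)] one(2)[OF assms(1)] by simp
  next
    case 3
    have "S * S = 1\<^sub>m 2"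
      using assms(1) by (auto simp: single_paulis_def single_pauli_products)
    then show ?thesis using 3 plain[OF c(1)] by simp
  qed (use phase single_pauli_products c in metis)+
  then show thesis using that by blast
qed

lemma single_pauli_square:
  assumes "S \<in> single_paulis"
  shows "S * S = 1\<^sub>m 2"
  using assms by (auto simp: single_paulis_def single_pauli_products)

lemma tensor_simps:
  "tensor [] = 1\<^sub>m 1" "tensor (S # Ss) = kron S (tensor Ss)"
  by (simp_all add: tensor_def)

lemma tensor_carrier:
  assumes "set Ss \<subseteq> single_paulis"
  shows "tensor Ss \<in> carrier_mat (2 ^ length Ss) (2 ^ length Ss)"
  using assms
  by (induction Ss) (auto simp: tensor_simps intro!: kron_carrier single_paulis_carrier)

lemma phases_mult: "c \<in> phases \<Longrightarrow> d \<in> phases \<Longrightarrow> c * d \<in> phases"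
  by (auto simp: phases_def)

lemma tensor_mult:
  assumes "length Ss = length Ts" "set Ss \<subseteq> single_paulis" "set Ts \<subseteq> single_paulis"
  shows "\<exists>c Us. c \<in> phases \<and> length Us = length Ss \<and> set Us \<subseteq> single_paulis \<and>
           tensor Ss * tensor Ts = c \<cdot>\<^sub>m tensor Us"
  using assms
proof (induction Ss Ts rule: list_induct2)
  case Nil
  show ?case
    by (intro exI[of _ 1] exI[of _ "[]"]) (simp add: tensor_simps phases_def smult_one)
next
  case (Cons S Ss T Ts)
  then obtain c Us where c: "c \<in> phases" "length Us = length Ss" "set Us \<subseteq> single_paulis"
    "tensor Ss * tensor Ts = c \<cdot>\<^sub>m tensor Us" by auto
  obtain d U where d: "d \<in> phases" "U \<in> single_paulis" "S * T = d \<cdot>\<^sub>m U"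
    using Cons.prems single_pauli_mult[of S T] by auto
  have ST: "S \<in> carrier_mat 2 2" "T \<in> carrier_mat 2 2" "U \<in> carrier_mat 2 2"
    using Cons.prems d single_paulis_carrier by auto
  have tens: "tensor Ss \<in> carrier_mat (2 ^ length Ss) (2 ^ length Ss)"
    "tensor Ts \<in> carrier_mat (2 ^ length Ss) (2 ^ length Ss)"
    "tensor Us \<in> carrier_mat (2 ^ length Ss) (2 ^ length Ss)"
    using Cons.prems Cons.hyps c tensor_carrier[of Ss] tensor_carrier[of Ts] tensor_carrier[of Us]
    by auto
  have "tensor (S # Ss) * tensor (T # Ts) = (d * c) \<cdot>\<^sub>m tensor (U # Us)"
    by (simp add: tensor_simps kron_mult[OF ST(1) tens(1) ST(2) tens(2)] c d
        kron_smult[OF ST(3) tens(3)])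
  then show ?case
    using c d by (intro exI[of _ "d * c"] exI[of _ "U # Us"]) (auto intro: phases_mult)
qed

lemma tensor_square:
  assumes "set Ss \<subseteq> single_paulis"
  shows "tensor Ss * tensor Ss = 1\<^sub>m (2 ^ length Ss)"
  using assms
proof (induction Ss)
  case (Cons S Ss)
  then have S: "S \<in> single_paulis" "S \<in> carrier_mat 2 2" using single_paulis_carrier by auto
  have t: "tensor Ss \<in> carrier_mat (2 ^ length Ss) (2 ^ length Ss)"
    using Cons.prems tensor_carrier[of Ss] by auto
  show ?case
    using Cons by (simp add: tensor_simps kron_mult[OF S(2) t S(2) t]
        single_pauli_square[OF S(1)] kron_one)
qed (simp add: tensor_simps)

lemma one_in_pauli_ops: "1\<^sub>m (2 ^ n) \<in> pauli_ops n"
proof -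
  have "tensor (replicate n (1\<^sub>m 2)) = 1\<^sub>m (2 ^ n)"
    by (induction n) (auto simp: tensor_simps kron_one)
  then show ?thesis
    unfolding pauli_ops_def
    by (intro CollectI exI[of _ "replicate n (1\<^sub>m 2)"]) (auto simp: single_paulis_def)
qed

lemma pauli_ops_carrier: "P \<in> pauli_ops n \<Longrightarrow> P \<in> carrier_mat (2 ^ n) (2 ^ n)"
  using tensor_carrier by (auto simp: pauli_ops_def)

lemma pauli_ops_square: "P \<in> pauli_ops n \<Longrightarrow> P * P = 1\<^sub>m (2 ^ n)"
  using tensor_square by (auto simp: pauli_ops_def)

lemma pauli_ops_mult:
  assumes "P \<in> pauli_ops n" "Q \<in> pauli_ops n"
  obtains c R where "c \<in> phases" "R \<in> pauli_ops n" "P * Q = c \<cdot>\<^sub>m R"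
proof -
  obtain Ss Ts where "P = tensor Ss" "length Ss = n" "set Ss \<subseteq> single_paulis"
    "Q = tensor Ts" "length Ts = n" "set Ts \<subseteq> single_paulis"
    using assms by (auto simp: pauli_ops_def)
  then obtain c Us where "c \<in> phases" "length Us = n" "set Us \<subseteq> single_paulis"
    "P * Q = c \<cdot>\<^sub>m tensor Us"
    using tensor_mult[of Ss Ts] by auto
  then show thesis
    using that[of c "tensor Us"] unfolding pauli_ops_def by blast
qed

lemma smult_mult_smult:
  fixes P Q :: "complex mat"
  assumes "P \<in> carrier_mat m m" "Q \<in> carrier_mat m m"
  shows "(c \<cdot>\<^sub>m P) * (d \<cdot>\<^sub>m Q) = (c * d) \<cdot>\<^sub>m (P * Q)"
proof -
  have "(c \<cdot>\<^sub>m P) * (d \<cdot>\<^sub>m Q) = c \<cdot>\<^sub>m (P * (d \<cdot>\<^sub>m Q))"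
    by (rule mult_smult_assoc_mat) (use assms in auto)
  also have "P * (d \<cdot>\<^sub>m Q) = d \<cdot>\<^sub>m (P * Q)"
    by (rule mult_smult_distrib) (use assms in auto)
  finally show ?thesis by (auto intro!: eq_matI)
qed

lemma group_pauli_group: "group (pauli_group n)"
proof (rule groupI)
  fix M N assume "M \<in> carrier (pauli_group n)" "N \<in> carrier (pauli_group n)"
  then obtain c P d Q where M: "M = c \<cdot>\<^sub>m P" "c \<in> phases" "P \<in> pauli_ops n"
    and N: "N = d \<cdot>\<^sub>m Q" "d \<in> phases" "Q \<in> pauli_ops n"
    by (auto simp: pauli_group_def)
  obtain e R where R: "e \<in> phases" "R \<in> pauli_ops n" "P * Q = e \<cdot>\<^sub>m R"
    using pauli_ops_mult[OF M(3) N(3)] by auto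
  have "M * N = (c * d * e) \<cdot>\<^sub>m R"
    using smult_mult_smult[OF pauli_ops_carrier[OF M(3)] pauli_ops_carrier[OF N(3)]] M N R
    by (auto intro!: eq_matI)
  then show "M \<otimes>\<^bsub>pauli_group n\<^esub> N \<in> carrier (pauli_group n)"
    using M N R by (auto simp: pauli_group_def intro!: phases_mult)
next
  show "\<one>\<^bsub>pauli_group n\<^esub> \<in> carrier (pauli_group n)"
    using one_in_pauli_ops smult_one[of "1\<^sub>m (2 ^ n)"] by (force simp: pauli_group_def phases_def)
next
  fix L M N
  assume "L \<in> carrier (pauli_group n)" "M \<in> carrier (pauli_group n)" "N \<in> carrier (pauli_group n)"
  then have "L \<in> carrier_mat (2 ^ n) (2 ^ n)" "M \<in> carrier_mat (2 ^ n) (2 ^ n)"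
    "N \<in> carrier_mat (2 ^ n) (2 ^ n)"
    using pauli_ops_carrier by (auto simp: pauli_group_def)
  then show "L \<otimes>\<^bsub>pauli_group n\<^esub> M \<otimes>\<^bsub>pauli_group n\<^esub> N = L \<otimes>\<^bsub>pauli_group n\<^esub> (M \<otimes>\<^bsub>pauli_group n\<^esub> N)"
    by (simp add: pauli_group_def)
next
  fix M assume "M \<in> carrier (pauli_group n)"
  then have "M \<in> carrier_mat (2 ^ n) (2 ^ n)"
    using pauli_ops_carrier by (auto simp: pauli_group_def)
  then show "\<one>\<^bsub>pauli_group n\<^esub> \<otimes>\<^bsub>pauli_group n\<^esub> M = M"
    by (simp add: pauli_group_def)
next
  fix M assume "M \<in> carrier (pauli_group n)"
  then obtain c P where M: "M = c \<cdot>\<^sub>m P" "c \<in> phases" "P \<in> pauli_ops n"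
    by (auto simp: pauli_group_def)
  have c: "cnj c \<in> phases" "cnj c * c = 1" using M(2) by (auto simp: phases_def)
  have "(cnj c \<cdot>\<^sub>m P) * M = 1\<^sub>m (2 ^ n)"
    using smult_mult_smult[OF pauli_ops_carrier[OF M(3)] pauli_ops_carrier[OF M(3)]] M c
      pauli_ops_square[OF M(3)] by (simp add: smult_one)
  then show "\<exists>N\<in>carrier (pauli_group n). N \<otimes>\<^bsub>pauli_group n\<^esub> M = \<one>\<^bsub>pauli_group n\<^esub>"
    using M c by (auto simp: pauli_group_def)
qed

lemma generate_pauli_ops:
  assumes "n \<ge> 1"
  shows "generate (pauli_group n) (pauli_ops n) = carrier (pauli_group n)"
proof -
  interpret group "pauli_group n" by (rule group_pauli_group)
  let ?gen = "generate (pauli_group n) (pauli_ops n)"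
  have mult: "M * N \<in> ?gen" if "M \<in> ?gen" "N \<in> ?gen" for M N
    using generate.eng[OF that] by (simp add: pauli_group_def)
  have incl: "pauli_ops n \<subseteq> carrier (pauli_group n)"
  proof
    fix P assume "P \<in> pauli_ops n"
    then show "P \<in> carrier (pauli_group n)"
      using smult_one[of P] unfolding pauli_group_def phases_def by force
  qed
  obtain m where n: "n = Suc m" using assms by (cases n) auto
  define E where "E S = kron S (1\<^sub>m (2 ^ m))" for S
  have E: "E S \<in> pauli_ops n" if "S \<in> single_paulis" for S
  proof -
    obtain Ss where "1\<^sub>m (2 ^ m) = tensor Ss" "length Ss = m" "set Ss \<subseteq> single_paulis"
      using one_in_pauli_ops[of m] by (auto simp: pauli_ops_def)
    then show ?thesis
      using that unfolding E_def pauli_ops_def n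
      by (intro CollectI exI[of _ "S # Ss"]) (auto simp: tensor_simps)
  qed
  have Emult: "E S * E T = E (S * T)" if "S \<in> carrier_mat 2 2" "T \<in> carrier_mat 2 2" for S T
    unfolding E_def using kron_mult[OF that(1) one_carrier_mat that(2) one_carrier_mat] by simp
  have "E pauli_X * E pauli_Y * E pauli_Z = \<i> \<cdot>\<^sub>m 1\<^sub>m (2 ^ n)"
  proof -
    have "E pauli_X * E pauli_Y * E pauli_Z = E ((\<i> \<cdot>\<^sub>m pauli_Z) * pauli_Z)"
      using pauli_carriers by (simp add: Emult single_pauli_products)
    also have "(\<i> \<cdot>\<^sub>m pauli_Z) * pauli_Z = \<i> \<cdot>\<^sub>m 1\<^sub>m 2"
      using smult_mult_smult[OF pauli_carriers(4) pauli_carriers(4), of \<i> 1]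
      by (simp add: smult_one single_pauli_products)
    also have "E (\<i> \<cdot>\<^sub>m 1\<^sub>m 2) = \<i> \<cdot>\<^sub>m 1\<^sub>m (2 ^ n)"
      using kron_smult[OF pauli_carriers(1) one_carrier_mat, of \<i> 1]
      by (simp add: E_def n smult_one kron_one)
    finally show ?thesis .
  qed
  moreover have "E S \<in> ?gen" if "S \<in> single_paulis" for S
    using E[OF that] by (rule generate.incl)
  ultimately have i: "\<i> \<cdot>\<^sub>m 1\<^sub>m (2 ^ n) \<in> ?gen"
    using mult by (metis insertCI single_paulis_def)
  have step: "\<i> \<cdot>\<^sub>m M \<in> ?gen" if M: "M \<in> ?gen" "M \<in> carrier_mat (2 ^ n) (2 ^ n)" for M
  proof -
    have "(\<i> \<cdot>\<^sub>m 1\<^sub>m (2 ^ n)) * M = \<i> \<cdot>\<^sub>m M"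
      using smult_mult_smult[OF one_carrier_mat M(2), of \<i> 1] M(2) by (simp add: smult_one)
    then show ?thesis using mult[OF i M(1)] by simp
  qed
  have "c \<cdot>\<^sub>m P \<in> ?gen" if c: "c \<in> phases" and P: "P \<in> pauli_ops n" for c P
  proof -
    have P0: "P \<in> ?gen" and car: "\<And>d. d \<cdot>\<^sub>m P \<in> carrier_mat (2 ^ n) (2 ^ n)"
      using P pauli_ops_carrier[OF P] by (auto intro: generate.incl)
    have g1: "1 \<cdot>\<^sub>m P \<in> ?gen" using P0 by (simp add: smult_one)
    have next_phase: "(\<i> * d) \<cdot>\<^sub>m P \<in> ?gen" if "d \<cdot>\<^sub>m P \<in> ?gen" for d
    proof -
      have "(\<i> * d) \<cdot>\<^sub>m P = \<i> \<cdot>\<^sub>m (d \<cdot>\<^sub>m P)" by (intro eq_matI) auto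
      then show ?thesis using step[OF that car] by simp
    qed
    have g2: "\<i> \<cdot>\<^sub>m P \<in> ?gen" using next_phase[OF g1] by simp
    have g3: "(- 1) \<cdot>\<^sub>m P \<in> ?gen" using next_phase[OF g2] by simp
    have g4: "(- \<i>) \<cdot>\<^sub>m P \<in> ?gen" using next_phase[OF g3] by simp
    show ?thesis using c g1 g2 g3 g4 by (auto simp: phases_def)
  qed
  then have "carrier (pauli_group n) \<subseteq> ?gen" by (auto simp: pauli_group_def)
  then show ?thesis using generate_incl[OF incl] by blast
qed

lemma finite_pauli_ops: "finite (pauli_ops n)"
proof -
  have "pauli_ops n = tensor ` {Ss. set Ss \<subseteq> single_paulis \<and> length Ss = n}"
    by (auto simp: pauli_ops_def)
  moreover have "finite {Ss. set Ss \<subseteq> single_paulis \<and> length Ss = n}"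
    by (rule finite_lists_length_eq) (simp add: single_paulis_def)
  ultimately show ?thesis by simp
qed

lemma independent_generators_exist:
  assumes "abelian_pauli_subgroup n A"
  shows "\<exists>Ps. independent_generators n A Ps"
proof -
  interpret group "pauli_group n" by (rule group_pauli_group)
  let ?gen = "generate (pauli_group n)"
  have sub: "subgroup A (pauli_group n)" and "A \<subseteq> pauli_ops n \<union> uminus ` pauli_ops n"
    using assms by (auto simp: abelian_pauli_subgroup_def)
  then have fin: "finite A" and car: "A \<subseteq> carrier (pauli_group n)"
    using finite_pauli_ops finite_subset subgroup.subset by (blast, blast)
  define F where "F S \<longleftrightarrow> S \<subseteq> A \<and> ?gen S = A" for S
  have "F A"
    using generate_subgroup_incl[OF subset_refl sub] generate.incl[of _ A] by (auto simp: F_def)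
  then obtain S where S: "F S" "\<And>T. F T \<Longrightarrow> card S \<le> card T"
    using ex_has_least_nat[of F A card] by blast
  have finS: "finite S" using S fin finite_subset by (auto simp: F_def)
  have "P \<notin> ?gen (S - {P})" if P: "P \<in> S" for P
  proof
    assume g: "P \<in> ?gen (S - {P})"
    have Sc: "S - {P} \<subseteq> carrier (pauli_group n)" using S car by (auto simp: F_def)
    have "S \<subseteq> ?gen (S - {P})" using g generate.incl[of _ "S - {P}"] by blast
    then have "?gen S \<subseteq> ?gen (S - {P})"
      using generate_subgroup_incl generate_is_subgroup[OF Sc] by blast
    moreover have "?gen (S - {P}) \<subseteq> ?gen S" by (rule mono_generate) auto
    ultimately have "F (S - {P})" using S by (auto simp: F_def)
    then show False using S(2) P finS by (metis card_Diff1_less not_le)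
  qed
  moreover obtain Ps where "set Ps = S" "distinct Ps"
    using finite_distinct_list[OF finS] by blast
  ultimately show ?thesis
    using S by (intro exI[of _ Ps]) (auto simp: independent_generators_def F_def)
qed

end

theory Submission
  imports Defs
begin

text \<open>
  If \<open>\<rho>\<close> has maximal information in \<open>A\<close>, every generator \<open>P\<close> of \<open>A\<close> has a definite value in \<open>\<rho>\<close>,
  so that a Pauli operator \<open>Q\<close> anticommuting with \<open>P\<close> has expectation \<open>0\<close>. Hence, if no
  nontrivial member of \<open>B\<close> commutes with all of \<open>A\<close>, all nontrivial members of \<open>B\<close> have expectation
  \<open>0\<close>, and expanding the projectors of \<open>B\<close> in the independent generators gives the uniform
  distribution. Conversely, if \<open>P \<noteq> 1\<close> lies in \<open>A\<close> and commutes with \<open>B\<close>, then \<open>P\<close> and the members of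
  \<open>B\<close> have a joint eigenstate; it has maximal information in \<open>B\<close> and gives \<open>P\<close> a definite value,
  so some outcomes in \<open>A\<close> are impossible.
\<close>

section \<open>Traces, adjoints and orthogonal projectors\<close>

lemma mat_adjoint_carrier [simp]:
  assumes "(M :: complex mat) \<in> carrier_mat r c"
  shows "mat_adjoint M \<in> carrier_mat c r"
  using assms by (auto simp: mat_adjoint_def)

lemma mat_adjoint_index:
  assumes "(M :: complex mat) \<in> carrier_mat r c" "i < c" "j < r"
  shows "mat_adjoint M $$ (i, j) = cnj (M $$ (j, i))"
  using assms by (auto simp: mat_adjoint_def mat_of_rows_def)

lemma mat_adjoint_one [simp]: "mat_adjoint (1\<^sub>m N :: complex mat) = 1\<^sub>m N"
  using carrier_matD[OF mat_adjoint_carrier[OF one_carrier_mat]]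
  by (intro eq_matI) (auto simp: mat_adjoint_index[OF one_carrier_mat])

lemma smult_smult_mat: "a \<cdot>\<^sub>m (b \<cdot>\<^sub>m M) = (a * b) \<cdot>\<^sub>m (M :: complex mat)"
  by (intro eq_matI) auto

text \<open>Serves to show that a product of two projectors vanishes when one operator multiplies it
  by two different eigenvalues.\<close>

lemma smult_mat_cancel:
  assumes "(M :: complex mat) \<in> carrier_mat N N" "a \<cdot>\<^sub>m M = b \<cdot>\<^sub>m M" "a \<noteq> b"
  shows "M = 0\<^sub>m N N"
proof (rule eq_matI)
  fix i j assume "i < dim_row (0\<^sub>m N N)" "j < dim_col (0\<^sub>m N N)"
  then show "M $$ (i, j) = 0\<^sub>m N N $$ (i, j)"
    using arg_cong[OF assms(2), of "\<lambda>K. K $$ (i, j)"] assms(1,3) by simp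
qed (use assms in auto)

lemma uminus_eq_smult: "- M = (- 1) \<cdot>\<^sub>m (M :: complex mat)"
  by (intro eq_matI) auto

lemma uminus_uminus_mat: "- (- M) = (M :: complex mat)"
  by (intro eq_matI) auto

lemma mat_adjoint_add:
  assumes "(M :: complex mat) \<in> carrier_mat r c" "K \<in> carrier_mat r c"
  shows "mat_adjoint (M + K) = mat_adjoint M + mat_adjoint K"
proof (rule eq_matI)
  fix i j assume "i < dim_row (mat_adjoint M + mat_adjoint K)"
    "j < dim_col (mat_adjoint M + mat_adjoint K)"
  then have ij: "i < c" "j < r"
    using mat_adjoint_carrier[OF assms(1)] mat_adjoint_carrier[OF assms(2)] by auto
  have MK: "M + K \<in> carrier_mat r c" using assms by simp
  show "mat_adjoint (M + K) $$ (i, j) = (mat_adjoint M + mat_adjoint K) $$ (i, j)"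
    using ij assms carrier_matD[OF mat_adjoint_carrier[OF assms(1)]]
      carrier_matD[OF mat_adjoint_carrier[OF assms(2)]]
    by (simp add: mat_adjoint_index[OF MK] mat_adjoint_index[OF assms(1)]
        mat_adjoint_index[OF assms(2)])
next
  have "M + K \<in> carrier_mat r c" using assms by simp
  from carrier_matD[OF mat_adjoint_carrier[OF this]]
  show "dim_row (mat_adjoint (M + K)) = dim_row (mat_adjoint M + mat_adjoint K)"
    "dim_col (mat_adjoint (M + K)) = dim_col (mat_adjoint M + mat_adjoint K)"
    using mat_adjoint_carrier[OF assms(2)] by auto
qed

lemma mat_adjoint_smult:
  assumes "(M :: complex mat) \<in> carrier_mat r c"
  shows "mat_adjoint (a \<cdot>\<^sub>m M) = cnj a \<cdot>\<^sub>m mat_adjoint M"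
proof (rule eq_matI)
  have aM: "a \<cdot>\<^sub>m M \<in> carrier_mat r c" using assms by simp
  note car = carrier_matD[OF mat_adjoint_carrier[OF assms]]
    carrier_matD[OF mat_adjoint_carrier[OF aM]]
  show "dim_row (mat_adjoint (a \<cdot>\<^sub>m M)) = dim_row (cnj a \<cdot>\<^sub>m mat_adjoint M)"
    "dim_col (mat_adjoint (a \<cdot>\<^sub>m M)) = dim_col (cnj a \<cdot>\<^sub>m mat_adjoint M)"
    using car by auto
  fix i j assume "i < dim_row (cnj a \<cdot>\<^sub>m mat_adjoint M)" "j < dim_col (cnj a \<cdot>\<^sub>m mat_adjoint M)"
  then show "mat_adjoint (a \<cdot>\<^sub>m M) $$ (i, j) = (cnj a \<cdot>\<^sub>m mat_adjoint M) $$ (i, j)"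
    using car assms by (simp add: mat_adjoint_index[OF aM] mat_adjoint_index[OF assms])
qed

lemma mat_adjoint_mult:
  assumes M: "(M :: complex mat) \<in> carrier_mat r c" and K: "K \<in> carrier_mat c d"
  shows "mat_adjoint (M * K) = mat_adjoint K * mat_adjoint M"
proof (rule eq_matI)
  have MK: "M * K \<in> carrier_mat r d" using assms by simp
  note car = carrier_matD[OF mat_adjoint_carrier[OF M]] carrier_matD[OF mat_adjoint_carrier[OF K]]
    carrier_matD[OF mat_adjoint_carrier[OF MK]]
  show "dim_row (mat_adjoint (M * K)) = dim_row (mat_adjoint K * mat_adjoint M)"
    "dim_col (mat_adjoint (M * K)) = dim_col (mat_adjoint K * mat_adjoint M)"
    using car by auto
  fix i j assume "i < dim_row (mat_adjoint K * mat_adjoint M)"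
    "j < dim_col (mat_adjoint K * mat_adjoint M)"
  then show "mat_adjoint (M * K) $$ (i, j) = (mat_adjoint K * mat_adjoint M) $$ (i, j)"
    using car assms
    by (simp add: mat_adjoint_index[OF MK] mat_adjoint_index[OF M] mat_adjoint_index[OF K]
        scalar_prod_def mult.commute)
qed

section \<open>Linearity and cyclicity of the trace\<close>

lemma mat_trace_smult: "mat_trace (a \<cdot>\<^sub>m M) = a * mat_trace M"
  if "M \<in> carrier_mat N N"
  using that by (simp add: mat_trace_def sum_distrib_left)

lemma mat_trace_add: "mat_trace (M + K) = mat_trace M + mat_trace K"
  if "M \<in> carrier_mat N N" "K \<in> carrier_mat N N"
  using that by (simp add: mat_trace_def sum.distrib)

lemma mat_trace_mult_commute: "mat_trace (M * K) = mat_trace (K * M)"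
  if "M \<in> carrier_mat r c" "K \<in> carrier_mat c r"
proof -
  have "mat_trace (M * K) = (\<Sum>i<r. \<Sum>j<c. M $$ (i, j) * K $$ (j, i))"
    using that by (simp add: mat_trace_def scalar_prod_def atLeast0LessThan)
  also have "\<dots> = (\<Sum>j<c. \<Sum>i<r. M $$ (i, j) * K $$ (j, i))" by (rule sum.swap)
  also have "\<dots> = mat_trace (K * M)"
    using that by (simp add: mat_trace_def scalar_prod_def atLeast0LessThan mult.commute)
  finally show ?thesis .
qed

lemma mat_trace_adjoint: "mat_trace (mat_adjoint M) = cnj (mat_trace M)"
  if M: "M \<in> carrier_mat N N"
  using M carrier_matD[OF mat_adjoint_carrier[OF M]]
  by (simp add: mat_trace_def mat_adjoint_index[OF M])

section \<open>Orthogonal projectors and the positivity of their trace\<close>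

definition orth_projector :: "nat \<Rightarrow> complex mat \<Rightarrow> bool" where
  "orth_projector N M \<longleftrightarrow> M \<in> carrier_mat N N \<and> mat_adjoint M = M \<and> M * M = M"

text \<open>Commutation both makes the product self-adjoint and lets its square regroup as
  \<open>M * M * (K * K)\<close>.\<close>

lemma orth_projector_mult:
  assumes M: "orth_projector N M" and K: "orth_projector N K" and comm: "M * K = K * M"
  shows "orth_projector N (M * K)"
proof -
  have c: "M \<in> carrier_mat N N" "K \<in> carrier_mat N N" using M K by (auto simp: orth_projector_def)
  note [simp] = assoc_mult_mat[of _ N N _ N _ N] mult_carrier_mat[of _ N N _ N]
  have "M * K * (M * K) = M * (K * M) * K" using c by simp
  also have "\<dots> = M * M * (K * K)" using c by (simp flip: comm)
  also have "\<dots> = M * K" using M K by (simp add: orth_projector_def)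
  finally show ?thesis
    using M K c mat_adjoint_mult[OF c] unfolding orth_projector_def by (simp flip: comm)
qed

text \<open>As \<open>T\<close> is the product of itself with its adjoint, its trace is its squared
  Hilbert-Schmidt norm.\<close>

lemma mat_trace_orth_projector:
  assumes T: "orth_projector N T"
  shows "mat_trace T = complex_of_real (\<Sum>i<N. \<Sum>j<N. (cmod (T $$ (j, i)))\<^sup>2)"
proof -
  have c: "T \<in> carrier_mat N N" and h: "mat_adjoint T = T" and i: "T * T = T"
    using T by (auto simp: orth_projector_def)
  have sq: "T $$ (i, j) * T $$ (j, i) = complex_of_real ((cmod (T $$ (j, i)))\<^sup>2)"
    if "i < N" "j < N" for i j
    using mat_adjoint_index[OF c that] h complex_norm_square[of "T $$ (j, i)"]
    by (simp add: mult.commute)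
  have "mat_trace T = mat_trace (T * T)" by (simp only: i)
  also have "\<dots> = (\<Sum>i<N. \<Sum>j<N. T $$ (i, j) * T $$ (j, i))"
    using c by (simp add: mat_trace_def scalar_prod_def atLeast0LessThan del: i)
  also have "\<dots> = complex_of_real (\<Sum>i<N. \<Sum>j<N. (cmod (T $$ (j, i)))\<^sup>2)"
    by (simp add: sq del: of_real_power)
  finally show ?thesis .
qed

text \<open>The Hilbert-Schmidt norm vanishes only at zero. Hence a nonzero projector can be divided
  by its trace to give a state.\<close>

lemma mat_trace_orth_projector_pos:
  assumes T: "orth_projector N T" and nz: "T \<noteq> 0\<^sub>m N N"
  obtains t where "0 < t" "mat_trace T = complex_of_real t"
proof
  let ?t = "\<Sum>i<N. \<Sum>j<N. (cmod (T $$ (j, i)))\<^sup>2"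
  show "mat_trace T = complex_of_real ?t" by (rule mat_trace_orth_projector[OF T])
  have "?t \<noteq> 0"
  proof
    assume "?t = 0"
    then have "T $$ (j, i) = 0" if "i < N" "j < N" for i j
      using that by (auto simp: sum_nonneg_eq_0_iff sum_nonneg)
    then have "T = 0\<^sub>m N N" using T by (intro eq_matI) (auto simp: orth_projector_def)
    then show False using nz by simp
  qed
  then show "0 < ?t" by (simp add: less_le sum_nonneg)
qed

section \<open>Density operators and expectation values\<close>

lemma cscalar_prod_mult_adjoint:
  assumes M: "(M :: complex mat) \<in> carrier_mat N N" and v: "v \<in> carrier_vec N" and w: "w \<in> carrier_vec N"
  shows "(M *\<^sub>v v) \<bullet>c w = v \<bullet>c (mat_adjoint M *\<^sub>v w)"
proof -
  have "(M *\<^sub>v v) \<bullet>c w = (\<Sum>i<N. \<Sum>j<N. M $$ (i, j) * v $ j * cnj (w $ i))"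
    using assms by (simp add: scalar_prod_def atLeast0LessThan sum_distrib_right)
  also have "\<dots> = (\<Sum>j<N. \<Sum>i<N. M $$ (i, j) * v $ j * cnj (w $ i))" by (rule sum.swap)
  also have "\<dots> = v \<bullet>c (mat_adjoint M *\<^sub>v w)"
    using assms carrier_matD[OF mat_adjoint_carrier[OF M]]
    by (simp add: scalar_prod_def atLeast0LessThan sum_distrib_left mat_adjoint_index[OF M]
        algebra_simps)
  finally show ?thesis .
qed

text \<open>This is the maximally mixed state on the range of \<open>T\<close>. It is positive
  because the quadratic form of \<open>T\<close> at \<open>v\<close> is the squared norm of
  \<open>T *\<^sub>v v\<close>.\<close>

lemma density_operator_of_projector:
  assumes T: "orth_projector (2 ^ n) T" and nz: "T \<noteq> 0\<^sub>m (2 ^ n) (2 ^ n)"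
  shows "density_operator n ((1 / mat_trace T) \<cdot>\<^sub>m T)"
proof -
  let ?N = "2 ^ n :: nat"
  have c: "T \<in> carrier_mat ?N ?N" and h: "mat_adjoint T = T" and i: "T * T = T"
    using T by (auto simp: orth_projector_def)
  obtain t where t: "0 < t" "mat_trace T = complex_of_real t"
    using mat_trace_orth_projector_pos[OF T nz] .
  have pos: "0 \<le> (T *\<^sub>v v) \<bullet>c v" if v: "v \<in> carrier_vec ?N" for v
  proof -
    have "(T *\<^sub>v v) \<bullet>c v = (T *\<^sub>v (T *\<^sub>v v)) \<bullet>c v"
      using assoc_mult_mat_vec[OF c c v] i by simp
    also have "\<dots> = (T *\<^sub>v v) \<bullet>c (T *\<^sub>v v)"
      using cscalar_prod_mult_adjoint[OF c _ v, of "T *\<^sub>v v"] c v h by simp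
    also have "\<dots> \<ge> 0" by (rule conjugate_square_ge_0_vec)
    finally show ?thesis .
  qed
  have "0 \<le> Re ((((1 / mat_trace T) \<cdot>\<^sub>m T) *\<^sub>v v) \<bullet>c v)" if v: "v \<in> carrier_vec ?N" for v
  proof -
    have "(((1 / mat_trace T) \<cdot>\<^sub>m T) *\<^sub>v v) \<bullet>c v = (1 / mat_trace T) * ((T *\<^sub>v v) \<bullet>c v)"
      using v c by (simp add: scalar_prod_def sum_distrib_left sum_distrib_right algebra_simps)
    then show ?thesis using pos[OF v] t by (simp add: less_eq_complex_def)
  qed
  then show ?thesis
    using c h t by (simp add: density_operator_def mat_adjoint_smult[OF c] mat_trace_smult[OF c])
qed

text \<open>By cyclicity the trace is the sum of the quadratic form of \<rho> over the columns of
  \<open>K\<close>.\<close>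

lemma density_operator_expectation_nonneg:
  assumes \<rho>: "density_operator n \<rho>" and K: "K \<in> carrier_mat (2 ^ n) (2 ^ n)"
  shows "0 \<le> Re (mat_trace (K * mat_adjoint K * \<rho>))"
proof -
  let ?N = "2 ^ n :: nat"
  have r: "\<rho> \<in> carrier_mat ?N ?N" using \<rho> by (simp add: density_operator_def)
  note aK = mat_adjoint_carrier[OF K]
  have "mat_trace (K * mat_adjoint K * \<rho>) = mat_trace (mat_adjoint K * (\<rho> * K))"
    using mat_trace_mult_commute[of K ?N ?N "mat_adjoint K * \<rho>"] K aK r
      assoc_mult_mat[OF K aK r] assoc_mult_mat[OF aK r K] mult_carrier_mat[OF aK r] by simp
  also have "\<dots> = (\<Sum>i<?N. (\<rho> *\<^sub>v col K i) \<bullet>c col K i)"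
    unfolding mat_trace_def
  proof (rule sum.cong)
    fix i assume "i \<in> {..<?N}"
    then show "(mat_adjoint K * (\<rho> * K)) $$ (i, i) = (\<rho> *\<^sub>v col K i) \<bullet>c col K i"
      using K aK r carrier_matD[OF aK]
      by (simp add: scalar_prod_def mat_adjoint_index[OF K] mult.commute)
  qed (use carrier_matD[OF aK] in auto)
  finally have "Re (mat_trace (K * mat_adjoint K * \<rho>)) = (\<Sum>i<?N. Re ((\<rho> *\<^sub>v col K i) \<bullet>c col K i))"
    by simp
  also have "\<dots> \<ge> 0"
    using \<rho> K by (intro sum_nonneg) (auto simp: density_operator_def)
  finally show ?thesis .
qed

text \<open>Taking adjoints reverses the product of two self-adjoint matrices, and cyclicity of the
  trace undoes the reversal.\<close>

lemma density_operator_expectation_real: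
  assumes \<rho>: "density_operator n \<rho>" and Q: "Q \<in> carrier_mat (2 ^ n) (2 ^ n)" "mat_adjoint Q = Q"
  shows "Im (mat_trace (Q * \<rho>)) = 0"
proof -
  let ?N = "2 ^ n :: nat"
  have r: "\<rho> \<in> carrier_mat ?N ?N" "mat_adjoint \<rho> = \<rho>" using \<rho> by (auto simp: density_operator_def)
  have "cnj (mat_trace (Q * \<rho>)) = mat_trace (\<rho> * Q)"
    using mat_trace_adjoint[of "Q * \<rho>" ?N] mat_adjoint_mult[OF Q(1) r(1)] Q r by simp
  also have "\<dots> = mat_trace (Q * \<rho>)" by (rule mat_trace_mult_commute[OF r(1) Q(1)])
  finally show ?thesis by (simp add: complex_eq_iff)
qed

text \<open>An orthogonal projector is the product of itself with its adjoint.\<close>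

lemma orth_projector_expectation_nonneg:
  assumes "density_operator n \<rho>" "orth_projector (2 ^ n) W"
  shows "0 \<le> Re (mat_trace (W * \<rho>))"
  using density_operator_expectation_nonneg[OF assms(1), of W] assms(2)
  by (auto simp: orth_projector_def)

text \<open>Positivity of the expectation of \<open>(W + t Q)\<^sup>2 = W + t Q + t\<^sup>2\<close> for all real \<open>t\<close> leaves no
  room for a linear term.\<close>

lemma expectation_eq_0:
  assumes \<rho>: "density_operator n \<rho>" and W: "orth_projector (2 ^ n) W" "mat_trace (W * \<rho>) = 0"
    and Q: "Q \<in> carrier_mat (2 ^ n) (2 ^ n)" "mat_adjoint Q = Q" "Q * Q = 1\<^sub>m (2 ^ n)"
    and WQ: "W * Q + Q * W = Q"
  shows "mat_trace (Q * \<rho>) = 0"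
proof -
  let ?N = "2 ^ n :: nat"
  have r: "\<rho> \<in> carrier_mat ?N ?N" "mat_trace \<rho> = 1" using \<rho> by (auto simp: density_operator_def)
  have w: "W \<in> carrier_mat ?N ?N" "mat_adjoint W = W" "W * W = W"
    using W by (auto simp: orth_projector_def)
  define q where "q = Re (mat_trace (Q * \<rho>))"
  have pos: "0 \<le> t * q + t * t" for t :: real
  proof -
    let ?t = "complex_of_real t"
    let ?K = "W + ?t \<cdot>\<^sub>m Q"
    have K: "?K \<in> carrier_mat ?N ?N" and tQ: "?t \<cdot>\<^sub>m Q \<in> carrier_mat ?N ?N" using w Q by auto
    have adj: "mat_adjoint ?K = ?K"
      using mat_adjoint_add[OF w(1) tQ] mat_adjoint_smult[OF Q(1)] w Q by simp
    have cWQ: "W * Q \<in> carrier_mat ?N ?N" "Q * W \<in> carrier_mat ?N ?N" using w Q by auto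
    note [simp] = assoc_mult_mat[of _ ?N ?N _ ?N _ ?N] mult_carrier_mat[of _ ?N ?N _ ?N]
    have "?K * ?K = (W * W + ?t \<cdot>\<^sub>m (Q * W)) + (?t \<cdot>\<^sub>m (W * Q) + (?t * ?t) \<cdot>\<^sub>m (Q * Q))"
      using w(1) Q(1) tQ K
      by (simp add: mult_add_distrib_mat[OF K w(1) tQ] add_mult_distrib_mat[OF w(1) tQ w(1)]
          add_mult_distrib_mat[OF w(1) tQ tQ] mult_smult_assoc_mat[OF Q(1) w(1)] mult_smult_distrib[OF w(1) Q(1)]
          smult_mult_smult[OF Q(1) Q(1)])
    also have "\<dots> = W + ?t \<cdot>\<^sub>m (W * Q + Q * W) + (?t * ?t) \<cdot>\<^sub>m 1\<^sub>m ?N"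
      unfolding w(3) Q(3) using w(1) Q(1) cWQ by (intro eq_matI) (auto simp: algebra_simps)
    \<comment> \<open>The hypothesis \<open>WQ\<close> says that \<open>Q\<close> anticommutes with
      the reflection 2W - 1; it reduces the cross terms to a multiple of \<open>Q\<close>.\<close>
    also have "\<dots> = W + ?t \<cdot>\<^sub>m Q + (?t * ?t) \<cdot>\<^sub>m 1\<^sub>m ?N" by (simp only: WQ)
    finally have KK: "?K * ?K * \<rho> = W * \<rho> + ?t \<cdot>\<^sub>m (Q * \<rho>) + (?t * ?t) \<cdot>\<^sub>m \<rho>"
      using w Q r tQ K
      by (simp add: add_mult_distrib_mat[OF _ _ r(1), of _ ?N] mult_smult_assoc_mat[OF Q(1) r(1)]
          mult_smult_assoc_mat[OF one_carrier_mat r(1)] assoc_add_mat[of _ ?N ?N])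
    have cc: "W * \<rho> \<in> carrier_mat ?N ?N" "Q * \<rho> \<in> carrier_mat ?N ?N" using w Q r by auto
    \<comment> \<open>The constant term drops out because \<open>W\<close> has expectation zero; the
      quadratic one has coefficient 1, the trace of \<rho>.\<close>
    have "mat_trace (?K * ?K * \<rho>) = ?t * mat_trace (Q * \<rho>) + ?t * ?t"
      unfolding KK using cc r W(2)
      by (simp add: mat_trace_add[of _ ?N] mat_trace_smult[of _ ?N])
    then show ?thesis
      using density_operator_expectation_nonneg[OF \<rho> K] adj by (simp add: q_def)
  qed
  \<comment> \<open>The point -q/2 is the minimum of the parabola, whose value there is
    -q*q/4.\<close>
  have "q * q \<le> 0" using pos[of "- q / 2"] by (simp add: field_simps)
  then have "q = 0" by (auto simp: mult_le_0_iff)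
  then show ?thesis
    using density_operator_expectation_real[OF \<rho> Q(1,2)] by (simp add: q_def complex_eq_iff)
qed

section \<open>Spectral projectors of involutions\<close>

text \<open>Self-adjointness is part of the notion so that the spectral projectors are orthogonal
  and not merely idempotent.\<close>

definition involution :: "nat \<Rightarrow> complex mat \<Rightarrow> bool" where
  "involution N P \<longleftrightarrow> P \<in> carrier_mat N N \<and> mat_adjoint P = P \<and> P * P = 1\<^sub>m N"

text \<open>For an involution \<open>P\<close> and a sign \<open>s\<close> this projects onto the
  eigenspace of \<open>P\<close> with eigenvalue \<open>s\<close>. The sign is a complex scalar to
  match the factors of \<open>projector\<close>.\<close>

definition eigenprojector :: "nat \<Rightarrow> complex \<Rightarrow> complex mat \<Rightarrow> complex mat" where
  "eigenprojector N s P = (1 / 2) \<cdot>\<^sub>m (1\<^sub>m N + s \<cdot>\<^sub>m P)"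

lemma eigenprojector_carrier [simp]:
  "P \<in> carrier_mat N N \<Longrightarrow> eigenprojector N s P \<in> carrier_mat N N"
  by (simp add: eigenprojector_def)

lemma eigenprojector_mult:
  assumes P: "P \<in> carrier_mat N N" and M: "M \<in> carrier_mat N N"
  shows "eigenprojector N s P * M = (1 / 2) \<cdot>\<^sub>m (M + s \<cdot>\<^sub>m (P * M))"
    and "M * eigenprojector N s P = (1 / 2) \<cdot>\<^sub>m (M + s \<cdot>\<^sub>m (M * P))"
proof -
  have c: "1\<^sub>m N + s \<cdot>\<^sub>m P \<in> carrier_mat N N" "s \<cdot>\<^sub>m P \<in> carrier_mat N N" using P by auto
  show "eigenprojector N s P * M = (1 / 2) \<cdot>\<^sub>m (M + s \<cdot>\<^sub>m (P * M))"
    unfolding eigenprojector_def mult_smult_assoc_mat[OF c(1) M]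
      add_mult_distrib_mat[OF one_carrier_mat c(2) M] mult_smult_assoc_mat[OF P M]
    using M by simp
  show "M * eigenprojector N s P = (1 / 2) \<cdot>\<^sub>m (M + s \<cdot>\<^sub>m (M * P))"
    unfolding eigenprojector_def mult_smult_distrib[OF M c(1)]
      mult_add_distrib_mat[OF M one_carrier_mat c(2)] mult_smult_distrib[OF M P]
    using M by simp
qed

text \<open>Since \<open>P\<close> and \<open>s\<close> both square to one, P(1 + sP) = P + s = s(1
  + sP).\<close>

lemma mult_eigenprojector:
  assumes P: "involution N P" and s: "s * s = 1"
  shows "P * eigenprojector N s P = s \<cdot>\<^sub>m eigenprojector N s P"
proof -
  have c: "P \<in> carrier_mat N N" "P * P = 1\<^sub>m N" using P by (auto simp: involution_def)
  have ss: "s * (s * z) = z" for z using s by (metis mult.assoc mult_1)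
  show ?thesis
    unfolding eigenprojector_mult(2)[OF c(1) c(1)] c(2) unfolding eigenprojector_def
    using c(1) by (intro eq_matI) (auto simp: ss algebra_simps)
qed

text \<open>The adjoint fixes the real sign \<open>s\<close> and \<open>P\<close>. Idempotence
  follows from the eigenvalue equation: E E = (E + s P E)/2 = (E + s s E)/2 = E.\<close>

lemma orth_projector_eigenprojector:
  assumes P: "involution N P" and s: "s \<in> {1, - 1}"
  shows "orth_projector N (eigenprojector N s P)"
proof -
  have c: "P \<in> carrier_mat N N" "mat_adjoint P = P" using P by (auto simp: involution_def)
  have s2: "s * s = 1" "cnj s = s" using s by auto
  let ?E = "eigenprojector N s P"
  have sP: "s \<cdot>\<^sub>m P \<in> carrier_mat N N" and c1: "1\<^sub>m N + s \<cdot>\<^sub>m P \<in> carrier_mat N N"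
    using c by auto
  have "mat_adjoint ?E = ?E"
    unfolding eigenprojector_def mat_adjoint_smult[OF c1] mat_adjoint_add[OF one_carrier_mat sP]
      mat_adjoint_smult[OF c(1)] mat_adjoint_one c(2) s2 by simp
  moreover have "?E * ?E = (1 / 2) \<cdot>\<^sub>m (?E + s \<cdot>\<^sub>m (s \<cdot>\<^sub>m ?E))"
    using eigenprojector_mult(1)[OF c(1), of ?E s] mult_eigenprojector[OF P s2(1)] c by simp
  moreover have "(1 / 2) \<cdot>\<^sub>m (?E + s \<cdot>\<^sub>m (s \<cdot>\<^sub>m ?E)) = ?E"
    using s c eigenprojector_carrier[of P N s] by (intro eq_matI) auto
  ultimately show ?thesis using c by (simp add: orth_projector_def)
qed

section \<open>Joint spectral projectors of a family of operators\<close>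

text \<open>The family and the list of indices are arbitrary, so that facts about
  \<open>projector\<close> can be proved by induction on the list.\<close>

definition joint_projector ::
  "nat \<Rightarrow> (nat \<Rightarrow> complex mat) \<Rightarrow> (nat \<Rightarrow> nat) \<Rightarrow> nat list \<Rightarrow> complex mat" where
  "joint_projector N P x ks = foldr (\<lambda>k M. eigenprojector N ((- 1) ^ x k) (P k) * M) ks (1\<^sub>m N)"

lemma joint_projector_simps [simp]:
  "joint_projector N P x [] = 1\<^sub>m N"
  "joint_projector N P x (k # ks) = eigenprojector N ((- 1) ^ x k) (P k) * joint_projector N P x ks"
  by (simp_all add: joint_projector_def)

lemma projector_eq_joint_projector:
  "projector n A x = joint_projector (2 ^ n) ((!) (generators n A)) x [0..<pauli_dim n A]"
  by (simp add: projector_def joint_projector_def eigenprojector_def)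

lemma joint_projector_carrier:
  assumes "\<And>k. k \<in> set ks \<Longrightarrow> P k \<in> carrier_mat N N"
  shows "joint_projector N P x ks \<in> carrier_mat N N"
  using assms by (induction ks) (auto intro!: mult_carrier_mat)

lemma joint_projector_cong:
  assumes "\<And>k. k \<in> set ks \<Longrightarrow> x k = y k"
  shows "joint_projector N P x ks = joint_projector N P y ks"
  using assms by (induction ks) auto

lemma eigenprojector_commute:
  assumes "P \<in> carrier_mat N N" "M \<in> carrier_mat N N" "P * M = M * P"
  shows "eigenprojector N s P * M = M * eigenprojector N s P"
  using assms by (simp add: eigenprojector_mult)

lemma joint_projector_commute:
  assumes "\<And>k. k \<in> set ks \<Longrightarrow> P k \<in> carrier_mat N N" "M \<in> carrier_mat N N"
    and "\<And>k. k \<in> set ks \<Longrightarrow> P k * M = M * P k"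
  shows "joint_projector N P x ks * M = M * joint_projector N P x ks"
  using assms
proof (induction ks)
  case (Cons k ks)
  let ?J = "joint_projector N P x ks" and ?E = "eigenprojector N ((- 1) ^ x k) (P k)"
  have c: "?J \<in> carrier_mat N N" "?E \<in> carrier_mat N N" "M \<in> carrier_mat N N"
    using Cons.prems by (auto intro: joint_projector_carrier)
  note [simp] = assoc_mult_mat[of _ N N _ N _ N] mult_carrier_mat[of _ N N _ N]
  have "?E * ?J * M = ?E * (M * ?J)" using c Cons by simp
  also have "\<dots> = ?E * M * ?J" using c by simp
  also have "?E * M = M * ?E" using Cons.prems by (intro eigenprojector_commute) auto
  finally show ?case using c by simp
qed simp

lemma neg_one_power_cases: "(- 1 :: complex) ^ k \<in> {1, - 1}"
  by (metis insertCI minus_one_power_iff)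

lemma orth_projector_joint_projector:
  assumes "\<And>k. k \<in> set ks \<Longrightarrow> involution N (P k)"
    and "\<And>j k. j \<in> set ks \<Longrightarrow> k \<in> set ks \<Longrightarrow> P j * P k = P k * P j"
  shows "orth_projector N (joint_projector N P x ks)"
  using assms
proof (induction ks)
  case Nil
  show ?case by (simp add: orth_projector_def)
next
  case (Cons k ks)
  let ?J = "joint_projector N P x ks" and ?E = "eigenprojector N ((- 1) ^ x k) (P k)"
  have c: "P j \<in> carrier_mat N N" if "j \<in> set (k # ks)" for j
    using Cons.prems(1)[OF that] by (simp add: involution_def)
  have J: "?J \<in> carrier_mat N N" using c by (intro joint_projector_carrier) auto
  have "?J * P k = P k * ?J" using c Cons.prems(2) by (intro joint_projector_commute) auto
  then have "?E * ?J = ?J * ?E" using c J by (intro eigenprojector_commute) auto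
  then show ?case
    using Cons neg_one_power_cases
    by (auto intro!: orth_projector_mult orth_projector_eigenprojector)
qed

text \<open>\<open>P k\<close> moves past the factors of other indices until it meets its own
  eigenprojector, which absorbs it and leaves the eigenvalue.\<close>

lemma mult_joint_projector:
  assumes inv: "\<And>k. k \<in> set ks \<Longrightarrow> involution N (P k)"
    and comm: "\<And>j k. j \<in> set ks \<Longrightarrow> k \<in> set ks \<Longrightarrow> P j * P k = P k * P j"
    and k: "k \<in> set ks"
  shows "P k * joint_projector N P x ks = (- 1) ^ x k \<cdot>\<^sub>m joint_projector N P x ks"
  using assms
proof (induction ks)
  case (Cons j ks)
  let ?J = "joint_projector N P x ks" and ?E = "eigenprojector N ((- 1) ^ x j) (P j)"
  have c: "P i \<in> carrier_mat N N" if "i \<in> set (j # ks)" for i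
    using Cons.prems(1)[OF that] by (simp add: involution_def)
  have J: "?J \<in> carrier_mat N N" using c by (intro joint_projector_carrier) auto
  have E: "?E \<in> carrier_mat N N" using c by simp
  have Pk: "P k \<in> carrier_mat N N" using c Cons.prems by simp
  have assoc: "P k * (?E * ?J) = P k * ?E * ?J" using Pk E J by simp
  show ?case
  proof (cases "k = j")
    case True
    have "P j * ?E = (- 1) ^ x j \<cdot>\<^sub>m ?E"
      using neg_one_power_cases[of "x j"] Cons.prems by (intro mult_eigenprojector) auto
    then show ?thesis using assoc True mult_smult_assoc_mat[OF E J] by simp
  next
    case False
    then have "P k * ?J = (- 1) ^ x k \<cdot>\<^sub>m ?J" using Cons by auto
    moreover have "P k * ?E = ?E * P k"
      using eigenprojector_commute[of "P j" N "P k"] c Cons.prems by auto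
    ultimately show ?thesis
      using assoc assoc_mult_mat[OF E Pk J] mult_smult_distrib[OF E J] by simp
  qed
qed simp

text \<open>At each index the projectors for the two bits resolve the identity, so a nonzero matrix
  survives at least one of them. Choosing such bits one after the other yields the outcome.\<close>

lemma joint_projector_nonzero:
  assumes inv: "\<And>k. k \<in> set ks \<Longrightarrow> P k \<in> carrier_mat N N" and d: "distinct ks"
    and M: "M \<in> carrier_mat N N" "M \<noteq> 0\<^sub>m N N"
  shows "\<exists>x. (\<forall>k. x k \<in> {0, 1}) \<and> joint_projector N P x ks * M \<noteq> 0\<^sub>m N N"
  using inv d
proof (induction ks)
  case Nil
  then show ?case using M by (intro exI[of _ "\<lambda>_. 0"]) auto
next
  case (Cons k ks)
  then obtain x where x: "\<forall>k. x k \<in> {0, 1}" "joint_projector N P x ks * M \<noteq> 0\<^sub>m N N" by auto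
  let ?J = "joint_projector N P x ks"
  have c: "P j \<in> carrier_mat N N" if "j \<in> set (k # ks)" for j
    using Cons.prems(1)[OF that] by simp
  have J: "?J \<in> carrier_mat N N" using c by (intro joint_projector_carrier) auto
  have JM: "?J * M \<in> carrier_mat N N" using J M by simp
  have Pk: "P k \<in> carrier_mat N N" using c by simp
  \<comment> \<open>By distinctness \<open>k\<close> does not occur in the tail, so its bit can be
    chosen without disturbing the projector found there.\<close>
  have upd: "joint_projector N P (x(k := b)) (k # ks) * M
      = eigenprojector N ((- 1) ^ b) (P k) * (?J * M)" for b
  proof -
    have "joint_projector N P (x(k := b)) ks = ?J"
      using Cons.prems by (intro joint_projector_cong) auto
    then show ?thesis
      using assoc_mult_mat[OF eigenprojector_carrier[OF Pk] J M(1)] by simp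
  qed
  \<comment> \<open>The two eigenprojectors of \<open>P k\<close> add up to the identity, so they
    cannot both annihilate \<open>?J * M\<close>.\<close>
  have "eigenprojector N ((- 1) ^ 0) (P k) * (?J * M) + eigenprojector N ((- 1) ^ 1) (P k) * (?J * M)
      = ?J * M"
    unfolding eigenprojector_mult(1)[OF Pk JM]
    using JM Pk by (intro eq_matI) (auto simp: field_simps simp del: index_mult_mat(1))
  then have "eigenprojector N ((- 1) ^ 0) (P k) * (?J * M) \<noteq> 0\<^sub>m N N
      \<or> eigenprojector N ((- 1) ^ 1) (P k) * (?J * M) \<noteq> 0\<^sub>m N N"
    using x(2) by (metis left_add_zero_mat zero_carrier_mat)
  then obtain b :: nat where "b \<in> {0, 1}" "eigenprojector N ((- 1) ^ b) (P k) * (?J * M) \<noteq> 0\<^sub>m N N"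
    by blast
  then have "\<forall>j. (x(k := b)) j \<in> {0, 1}"
    "joint_projector N P (x(k := b)) (k # ks) * M \<noteq> 0\<^sub>m N N"
    using x(1) by (auto simp only: upd fun_upd_apply split: if_split)
  then show ?case by blast
qed

section \<open>Pauli operators as involutions\<close>

lemma mat_adjoint_kron:
  assumes A: "A \<in> carrier_mat a a" and B: "B \<in> carrier_mat b b"
  shows "mat_adjoint (kron A B) = kron (mat_adjoint A) (mat_adjoint B)"
proof (rule eq_matI)
  have c: "kron A B \<in> carrier_mat (a * b) (a * b)" using kron_carrier[OF A B] .
  note d = carrier_matD[OF mat_adjoint_carrier[OF c]] carrier_matD[OF mat_adjoint_carrier[OF A]]
    carrier_matD[OF mat_adjoint_carrier[OF B]]
  show "dim_row (mat_adjoint (kron A B)) = dim_row (kron (mat_adjoint A) (mat_adjoint B))"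
    "dim_col (mat_adjoint (kron A B)) = dim_col (kron (mat_adjoint A) (mat_adjoint B))"
    using d by (simp_all add: kron_def)
  fix i j assume "i < dim_row (kron (mat_adjoint A) (mat_adjoint B))"
    "j < dim_col (kron (mat_adjoint A) (mat_adjoint B))"
  then have ij: "i < a * b" "j < a * b" using d by (simp_all add: kron_def)
  then have "0 < b" by (cases b) auto
  then have "i div b < a" "j div b < a" "i mod b < b" "j mod b < b"
    using ij by (auto simp: less_mult_imp_div_less)
  then show "mat_adjoint (kron A B) $$ (i, j) = kron (mat_adjoint A) (mat_adjoint B) $$ (i, j)"
    unfolding mat_adjoint_index[OF c ij] using ij d A B
    by (simp add: kron_def mat_adjoint_index[OF A] mat_adjoint_index[OF B])
qed

lemma single_pauli_adjoint:
  assumes "S \<in> single_paulis"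
  shows "mat_adjoint S = S"
proof -
  have c: "S \<in> carrier_mat 2 2" by (rule single_paulis_carrier[OF assms])
  show ?thesis
    using assms
    by (intro eq_mat2I[OF mat_adjoint_carrier[OF c] c])
      (auto simp: mat_adjoint_index[OF c] single_paulis_def pauli_entries simp del: One_nat_def)
qed

lemma tensor_adjoint:
  assumes "set Ss \<subseteq> single_paulis"
  shows "mat_adjoint (tensor Ss) = tensor Ss"
  using assms
proof (induction Ss)
  case Nil
  show ?case
    by (simp add: tensor_simps)
next
  case (Cons S Ss)
  then have S: "S \<in> single_paulis" and Ss: "set Ss \<subseteq> single_paulis" by auto
  show ?case
    using Cons.IH[OF Ss] single_pauli_adjoint[OF S]
      mat_adjoint_kron[OF single_paulis_carrier[OF S] tensor_carrier[OF Ss]]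
    by (simp add: tensor_simps)
qed

lemma pauli_ops_involution:
  assumes "P \<in> pauli_ops n"
  shows "involution (2 ^ n) P"
  using assms pauli_ops_carrier[OF assms] pauli_ops_square[OF assms] tensor_adjoint
  by (auto simp: involution_def pauli_ops_def)

lemma single_pauli_commute:
  assumes "S \<in> single_paulis" "T \<in> single_paulis"
  shows "\<exists>e\<in>{1, - 1}. S * T = e \<cdot>\<^sub>m (T * S)"
proof (cases "S = 1\<^sub>m 2 \<or> T = 1\<^sub>m 2 \<or> S = T")
  case True
  then have "S * T = 1 \<cdot>\<^sub>m (T * S)"
    using single_paulis_carrier[OF assms(1)] single_paulis_carrier[OF assms(2)]
    by (auto simp: smult_one)
  then show ?thesis by blast
next
  case False
  \<comment> \<open>The two orders of a product of distinct nontrivial Pauli matrices differ only in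
    the phase, \<open>\<i>\<close> against \<open>- \<i>\<close>.\<close>
  have "(- 1) \<cdot>\<^sub>m (c \<cdot>\<^sub>m M) = (- c) \<cdot>\<^sub>m M" for c :: complex and M
    by (intro eq_matI) auto
  then have "S * T = (- 1) \<cdot>\<^sub>m (T * S)"
    using assms False by (auto simp: single_paulis_def single_pauli_products)
  then show ?thesis by blast
qed

text \<open>The commutation signs of the tensor factors multiply, and a product of signs is a
  sign.\<close>

lemma tensor_commute:
  assumes "length Ss = length Ts" "set Ss \<subseteq> single_paulis" "set Ts \<subseteq> single_paulis"
  shows "\<exists>e\<in>{1, - 1}. tensor Ss * tensor Ts = e \<cdot>\<^sub>m (tensor Ts * tensor Ss)"
  using assms
proof (induction Ss Ts rule: list_induct2)
  case Nil
  show ?case by (intro bexI[of _ 1]) (auto simp: tensor_simps smult_one)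
next
  case (Cons S Ss T Ts)
  then obtain e where e: "e \<in> {1, - 1}" "tensor Ss * tensor Ts = e \<cdot>\<^sub>m (tensor Ts * tensor Ss)"
    by auto
  obtain d where d: "d \<in> {1, - 1}" "S * T = d \<cdot>\<^sub>m (T * S)"
    using Cons.prems single_pauli_commute[of S T] by auto
  have ST: "S \<in> carrier_mat 2 2" "T \<in> carrier_mat 2 2" "T * S \<in> carrier_mat 2 2"
    using Cons.prems single_paulis_carrier by (auto intro!: mult_carrier_mat)
  let ?N = "2 ^ length Ss :: nat"
  have t: "tensor Ss \<in> carrier_mat ?N ?N" "tensor Ts \<in> carrier_mat ?N ?N"
    using Cons.prems Cons.hyps tensor_carrier[of Ss] tensor_carrier[of Ts] by auto
  have "tensor (S # Ss) * tensor (T # Ts) = (d * e) \<cdot>\<^sub>m (tensor (T # Ts) * tensor (S # Ss))"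
    unfolding tensor_simps kron_mult[OF ST(1) t(1) ST(2) t(2)] kron_mult[OF ST(2) t(2) ST(1) t(1)]
      d(2) e(2) by (rule kron_smult[OF ST(3) mult_carrier_mat[OF t(2) t(1)]])
  moreover have "d * e \<in> {1, - 1}" using d(1) e(1) by auto
  ultimately show ?case by blast
qed

lemma pauli_ops_commute:
  assumes "P \<in> pauli_ops n" "Q \<in> pauli_ops n"
  shows "P * Q = Q * P \<or> P * Q = - (Q * P)"
proof -
  obtain Ss Ts where "P = tensor Ss" "length Ss = n" "set Ss \<subseteq> single_paulis"
    "Q = tensor Ts" "length Ts = n" "set Ts \<subseteq> single_paulis"
    using assms by (auto simp: pauli_ops_def)
  then show ?thesis
    using tensor_commute[of Ss Ts] by (auto simp: smult_one uminus_eq_smult)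
qed

text \<open>The top left entry of a tensor product is the product of those of its factors, which are
  0 or 1 for single Pauli matrices. It is therefore never -1.\<close>

lemma neg_one_notin_pauli_ops: "- 1\<^sub>m (2 ^ n) \<notin> pauli_ops n"
proof
  assume "- 1\<^sub>m (2 ^ n) \<in> pauli_ops n"
  then obtain Ss where Ss: "tensor Ss = - 1\<^sub>m (2 ^ n)" "set Ss \<subseteq> single_paulis"
    by (auto simp: pauli_ops_def)
  have "tensor Ss $$ (0, 0) \<in> {0, 1}" using Ss(2)
  proof (induction Ss)
    case (Cons S Ss)
    then have "S \<in> carrier_mat 2 2" "tensor Ss \<in> carrier_mat (2 ^ length Ss) (2 ^ length Ss)"
      using single_paulis_carrier tensor_carrier by auto
    then have "tensor (S # Ss) $$ (0, 0) = S $$ (0, 0) * tensor Ss $$ (0, 0)"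
      by (simp add: tensor_simps kron_def)
    moreover have "S $$ (0, 0) \<in> {0, 1}"
      using Cons.prems by (auto simp: single_paulis_def pauli_entries)
    ultimately show ?case using Cons by auto
  qed (simp add: tensor_simps)
  then show False by (simp add: Ss(1))
qed

section \<open>Abelian subgroups and their joint projectors\<close>

lemma pauli_group_simps [simp]:
  "M \<otimes>\<^bsub>pauli_group n\<^esub> K = M * K" "\<one>\<^bsub>pauli_group n\<^esub> = 1\<^sub>m (2 ^ n)"
  by (simp_all add: pauli_group_def)

lemma abelian_pauli_subgroup_cases:
  assumes "abelian_pauli_subgroup n A" "P \<in> A"
  shows "P \<in> pauli_ops n \<or> - P \<in> pauli_ops n"
  using assms uminus_uminus_mat by (fastforce simp: abelian_pauli_subgroup_def)

text \<open>A member is a Pauli operator up to sign; the sign is real, so adjoints respect it, and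
  it cancels in the square.\<close>

lemma abelian_pauli_subgroup_involution:
  assumes "abelian_pauli_subgroup n A" "P \<in> A"
  shows "involution (2 ^ n) P"
  using abelian_pauli_subgroup_cases[OF assms]
proof
  assume "- P \<in> pauli_ops n"
  then have "involution (2 ^ n) (- P)" by (rule pauli_ops_involution)
  then have i: "- P \<in> carrier_mat (2 ^ n) (2 ^ n)" "mat_adjoint (- P) = - P"
    "- P * - P = 1\<^sub>m (2 ^ n)" by (auto simp: involution_def)
  have c: "P \<in> carrier_mat (2 ^ n) (2 ^ n)" using i by simp
  have "mat_adjoint P = - mat_adjoint (- P)"
    using mat_adjoint_smult[OF i(1), of "- 1"] by (simp flip: uminus_eq_smult add: uminus_uminus_mat)
  moreover have "- P * - P = P * P"
    using smult_mult_smult[OF c c, of "- 1" "- 1"] by (simp add: uminus_eq_smult smult_one)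
  ultimately show ?thesis using i c by (simp add: involution_def uminus_uminus_mat)
qed (rule pauli_ops_involution)

text \<open>The signs of the two members factor out of both products alike, which reduces the claim
  to Pauli operators.\<close>

lemma abelian_pauli_subgroup_commute_cases:
  assumes A: "abelian_pauli_subgroup n A" "P \<in> A" and B: "abelian_pauli_subgroup n B" "Q \<in> B"
  shows "P * Q = Q * P \<or> P * Q = - (Q * P)"
proof -
  obtain d P' where P: "P = d \<cdot>\<^sub>m P'" "P' \<in> pauli_ops n"
    using abelian_pauli_subgroup_cases[OF A] uminus_eq_smult uminus_uminus_mat smult_one by metis
  obtain e Q' where Q: "Q = e \<cdot>\<^sub>m Q'" "Q' \<in> pauli_ops n"
    using abelian_pauli_subgroup_cases[OF B] uminus_eq_smult uminus_uminus_mat smult_one by metis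
  note c = pauli_ops_carrier[OF P(2)] pauli_ops_carrier[OF Q(2)]
  have "P * Q = (d * e) \<cdot>\<^sub>m (P' * Q')" "Q * P = (d * e) \<cdot>\<^sub>m (Q' * P')"
    using smult_mult_smult[OF c] smult_mult_smult[OF c(2) c(1)] by (simp_all add: P Q mult.commute)
  moreover have "(d * e) \<cdot>\<^sub>m - M = - ((d * e) \<cdot>\<^sub>m M)" for M :: "complex mat"
    by (intro eq_matI) auto
  ultimately show ?thesis using pauli_ops_commute[OF P(2) Q(2)] by auto
qed

lemma abelian_pauli_subgroup_mult:
  assumes "abelian_pauli_subgroup n A" "P \<in> A" "Q \<in> A"
  shows "P * Q \<in> A"
  using assms subgroup.m_closed[of A "pauli_group n"] by (auto simp: abelian_pauli_subgroup_def)

lemma abelian_pauli_subgroup_one: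
  assumes "abelian_pauli_subgroup n A"
  shows "1\<^sub>m (2 ^ n) \<in> A"
  using assms subgroup.one_closed[of A "pauli_group n"] by (auto simp: abelian_pauli_subgroup_def)

text \<open>Members of \<open>A\<close> are their own inverses, so the inverse case of
  \<open>generate\<close> merges with that of the generators. Membership in \<open>A\<close> is
  carried along for use in the product case.\<close>

lemma generate_abelian_induct [consumes 3, case_names one incl mult]:
  assumes A: "abelian_pauli_subgroup n A" and S: "S \<subseteq> A"
    and R: "R \<in> generate (pauli_group n) S"
    and one: "Q (1\<^sub>m (2 ^ n))" and incl: "\<And>P. P \<in> S \<Longrightarrow> Q P"
    and mult: "\<And>P P'. P \<in> A \<Longrightarrow> P' \<in> A \<Longrightarrow> Q P \<Longrightarrow> Q P' \<Longrightarrow> Q (P * P')"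
  shows "R \<in> A \<and> Q R"
  using R
proof induction
  case one
  then show ?case using abelian_pauli_subgroup_one[OF A] assms(4) by simp
next
  case (incl P)
  then show ?case using S assms(5) by auto
next
  case (inv P)
  interpret group "pauli_group n" by (rule group_pauli_group)
  have "P \<in> carrier (pauli_group n)"
    using inv S A subgroup.subset by (fastforce simp: abelian_pauli_subgroup_def)
  moreover have "P * P = 1\<^sub>m (2 ^ n)"
    using abelian_pauli_subgroup_involution[OF A] inv S by (auto simp: involution_def)
  ultimately have "inv\<^bsub>pauli_group n\<^esub> P = P" by (intro inv_equality) auto
  then show ?case using inv S assms(5) by auto
next
  case (eng P P')
  then show ?case using abelian_pauli_subgroup_mult[OF A] assms(6) by simp
qed

lemma bit_vectors_eqI:
  assumes "x \<in> bit_vectors m" "y \<in> bit_vectors m" "\<And>k. k < m \<Longrightarrow> x k = y k"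
  shows "x = y"
  by (rule PiE_ext) (use assms in \<open>auto simp only: bit_vectors_def lessThan_iff\<close>)

lemma bit_vectors_mem: "x \<in> bit_vectors m \<Longrightarrow> k < m \<Longrightarrow> x k \<in> {0, 1}"
  using PiE_mem[of x "{..<m}" "\<lambda>_. {0, 1}" k] by (simp add: bit_vectors_def)

section \<open>The measurement projectors of one Abelian subgroup\<close>

context
  fixes n :: nat and A :: "complex mat set"
  assumes A: "abelian_pauli_subgroup n A"
begin

lemma independent_generators_generators: "independent_generators n A (generators n A)"
  unfolding generators_def by (rule someI_ex[OF independent_generators_exist[OF A]])

lemma generate_generators: "generate (pauli_group n) (set (generators n A)) = A"
  using independent_generators_generators by (simp add: independent_generators_def)

lemma generators_subset: "set (generators n A) \<subseteq> A"
  using generate.incl[of _ "set (generators n A)" "pauli_group n"] generate_generators by auto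

lemma generator_mem: "k < pauli_dim n A \<Longrightarrow> generators n A ! k \<in> A"
  using generators_subset by (auto simp: pauli_dim_def)

lemma generator_mem_upt: "k \<in> set [0..<pauli_dim n A] \<Longrightarrow> generators n A ! k \<in> A"
  using generator_mem by simp

lemma member_carrier: "P \<in> A \<Longrightarrow> P \<in> carrier_mat (2 ^ n) (2 ^ n)"
  using abelian_pauli_subgroup_involution[OF A] by (auto simp: involution_def)

lemma member_commute: "P \<in> A \<Longrightarrow> Q \<in> A \<Longrightarrow> P * Q = Q * P"
  using A by (simp add: abelian_pauli_subgroup_def)

lemma orth_projector_projector: "orth_projector (2 ^ n) (projector n A x)"
  unfolding projector_eq_joint_projector
  by (rule orth_projector_joint_projector[OF abelian_pauli_subgroup_involution[OF A generator_mem_upt]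
        member_commute[OF generator_mem_upt generator_mem_upt]])

lemma projector_carrier: "projector n A x \<in> carrier_mat (2 ^ n) (2 ^ n)"
  using orth_projector_projector by (simp add: orth_projector_def)

lemma generator_mult_projector:
  assumes "k < pauli_dim n A"
  shows "generators n A ! k * projector n A x = (- 1) ^ x k \<cdot>\<^sub>m projector n A x"
  unfolding projector_eq_joint_projector
  by (rule mult_joint_projector[OF abelian_pauli_subgroup_involution[OF A generator_mem_upt]
        member_commute[OF generator_mem_upt generator_mem_upt]]) (use assms in auto)

lemma projector_commute:
  assumes "M \<in> carrier_mat (2 ^ n) (2 ^ n)" "\<And>P. P \<in> A \<Longrightarrow> P * M = M * P"
  shows "projector n A x * M = M * projector n A x"
  unfolding projector_eq_joint_projector
  by (rule joint_projector_commute[OF member_carrier[OF generator_mem_upt] assms(1)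
        assms(2)[OF generator_mem_upt]])

text \<open>Turns an outcome given as a total function into an extensional one, as membership in
  \<open>bit_vectors\<close> demands.\<close>

lemma projector_restrict:
  "projector n A (restrict x {..<pauli_dim n A}) = projector n A x"
  unfolding projector_eq_joint_projector by (rule joint_projector_cong) auto

text \<open>Each generator acts on the range of the projector as a sign, and this property passes to
  products. So an outcome assigns a definite value to every member, not only to the
  generators.\<close>

lemma member_mult_projector:
  assumes "R \<in> A"
  shows "\<exists>c\<in>{1, - 1}. R * projector n A x = c \<cdot>\<^sub>m projector n A x"
proof -
  let ?\<Pi> = "projector n A x"
  have "R \<in> generate (pauli_group n) (set (generators n A))" using assms generate_generators by simp
  from A generators_subset this
  have "R \<in> A \<and> (\<exists>c\<in>{1, - 1}. R * ?\<Pi> = c \<cdot>\<^sub>m ?\<Pi>)"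
  proof (induction rule: generate_abelian_induct)
    case one
    then show ?case using left_mult_one_mat[OF projector_carrier] by (simp add: smult_one)
  next
    case (incl P)
    then obtain k where "k < pauli_dim n A" "P = generators n A ! k"
      by (auto simp: in_set_conv_nth pauli_dim_def)
    then show ?case
      using generator_mult_projector neg_one_power_cases by (metis (no_types))
  next
    case (mult P P')
    then obtain c d where cd: "c \<in> {1, - 1}" "d \<in> {1, - 1}" "P * ?\<Pi> = c \<cdot>\<^sub>m ?\<Pi>" "P' * ?\<Pi> = d \<cdot>\<^sub>m ?\<Pi>"
      by auto
    have "P * P' * ?\<Pi> = P * (P' * ?\<Pi>)"
      by (rule assoc_mult_mat[OF member_carrier[OF mult(1)] member_carrier[OF mult(2)]
            projector_carrier])
    also have "\<dots> = (d * c) \<cdot>\<^sub>m ?\<Pi>"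
      using mult_smult_distrib[OF member_carrier[OF mult(1)] projector_carrier] cd
      by (auto simp: smult_smult_mat)
    finally have "P * P' * ?\<Pi> = (d * c) \<cdot>\<^sub>m ?\<Pi>" .
    moreover have "d * c \<in> {1, - 1}" using cd by auto
    ultimately show ?case by blast
  qed
  then show ?thesis by blast
qed

lemma projector_nonzero:
  assumes M: "M \<in> carrier_mat (2 ^ n) (2 ^ n)" "M \<noteq> 0\<^sub>m (2 ^ n) (2 ^ n)"
  shows "\<exists>x\<in>bit_vectors (pauli_dim n A). projector n A x * M \<noteq> 0\<^sub>m (2 ^ n) (2 ^ n)"
proof -
  obtain x where x: "\<forall>k. x k \<in> {0, 1}" "projector n A x * M \<noteq> 0\<^sub>m (2 ^ n) (2 ^ n)"
    using joint_projector_nonzero[of "[0..<pauli_dim n A]" "(!) (generators n A)" "2 ^ n", OF _ _ M]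
      generator_mem member_carrier unfolding projector_eq_joint_projector by auto
  have "restrict x {..<pauli_dim n A} \<in> bit_vectors (pauli_dim n A)"
    using x(1) by (auto simp: bit_vectors_def)
  then show ?thesis using x(2) projector_restrict by metis
qed

text \<open>A generator at which the outcomes differ, inserted between the two projectors, can be
  absorbed by either of them; the resulting signs are opposite.\<close>

lemma projector_orthogonal:
  assumes "x \<in> bit_vectors (pauli_dim n A)" "y \<in> bit_vectors (pauli_dim n A)" "x \<noteq> y"
  shows "projector n A y * projector n A x = 0\<^sub>m (2 ^ n) (2 ^ n)"
proof -
  let ?X = "projector n A x" and ?Y = "projector n A y"
  note X = projector_carrier[of x] and Y = projector_carrier[of y]
  obtain k where k: "k < pauli_dim n A" "x k \<noteq> y k"
    using bit_vectors_eqI[OF assms(1,2)] assms(3) by blast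
  have xy: "x k \<in> {0, 1}" "y k \<in> {0, 1}"
    using bit_vectors_mem[OF assms(1) k(1)] bit_vectors_mem[OF assms(2) k(1)] by auto
  let ?P = "generators n A ! k"
  have P: "?P \<in> A" "?P \<in> carrier_mat (2 ^ n) (2 ^ n)" using generator_mem member_carrier k by auto
  have "?Y * ?P = ?P * ?Y" by (rule projector_commute[OF P(2) member_commute[OF _ P(1)]])
  then have "(- 1) ^ y k \<cdot>\<^sub>m (?Y * ?X) = ?Y * ?P * ?X"
    using generator_mult_projector[OF k(1)] mult_smult_assoc_mat[OF Y X] by simp
  also have "\<dots> = ?Y * (?P * ?X)" by (rule assoc_mult_mat[OF Y P(2) X])
  also have "\<dots> = (- 1) ^ x k \<cdot>\<^sub>m (?Y * ?X)"
    using generator_mult_projector[OF k(1)] mult_smult_distrib[OF Y X] by simp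
  finally have "(- 1) ^ y k \<cdot>\<^sub>m (?Y * ?X) = (- 1) ^ x k \<cdot>\<^sub>m (?Y * ?X)" .
  moreover have "(- 1 :: complex) ^ y k \<noteq> (- 1) ^ x k" using xy k(2) by auto
  ultimately show ?thesis using smult_mat_cancel[OF mult_carrier_mat[OF Y X]] by blast
qed

section \<open>Uniform statistics from vanishing expectations\<close>

text \<open>Expanding the joint projector yields products of \<open>R\<close> with elements of the
  generated subgroup. None of them is the identity, since \<open>R\<close> lies outside that
  subgroup, so each has expectation zero. Splitting off one factor replaces \<open>R\<close> by
  \<open>R * P k\<close> in half of the terms; hence \<open>R\<close> is arbitrary in the
  induction.\<close>

lemma trace_generated_projector_eq_0:
  assumes ks: "\<And>k. k \<in> set ks \<Longrightarrow> P k \<in> A" and R: "R \<in> A"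
    and notin: "R \<notin> generate (pauli_group n) (P ` set ks)"
    and \<rho>: "\<rho> \<in> carrier_mat (2 ^ n) (2 ^ n)"
    and zero: "\<And>Q. Q \<in> A \<Longrightarrow> Q \<noteq> 1\<^sub>m (2 ^ n) \<Longrightarrow> mat_trace (Q * \<rho>) = 0"
  shows "mat_trace (R * (joint_projector (2 ^ n) P x ks * \<rho>)) = 0"
  using ks R notin
proof (induction ks arbitrary: R)
  case Nil
  have "R \<noteq> 1\<^sub>m (2 ^ n)" using Nil generate.one[of "pauli_group n" "{}"] by auto
  then show ?case using zero[OF Nil(2)] \<rho> by simp
next
  case (Cons k ks)
  let ?N = "2 ^ n :: nat" and ?gen = "generate (pauli_group n)"
  let ?J = "joint_projector ?N P x ks" and ?E = "eigenprojector ?N ((- 1) ^ x k) (P k)"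
  have Pk: "P k \<in> A" using Cons.prems by simp
  note c = member_carrier[OF Pk] member_carrier[OF Cons.prems(2)]
  have J: "?J \<in> carrier_mat ?N ?N"
    using Cons.prems member_carrier by (intro joint_projector_carrier) auto
  have J\<rho>: "?J * \<rho> \<in> carrier_mat ?N ?N" using J \<rho> by simp
  have PJ: "P k * (?J * \<rho>) \<in> carrier_mat ?N ?N" using c J\<rho> by simp
  have RJ: "R * (?J * \<rho>) \<in> carrier_mat ?N ?N" "R * P k * (?J * \<rho>) \<in> carrier_mat ?N ?N"
    using c J\<rho> by auto
  have mono: "?gen (P ` set ks) \<subseteq> ?gen (P ` set (k # ks))"
    using group.mono_generate[OF group_pauli_group] by (metis image_mono set_subset_Cons)
  \<comment> \<open>As \<open>P k\<close> squares to the identity, multiplying by it once more would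
    bring \<open>R\<close> itself into the subgroup.\<close>
  have RP: "R * P k \<notin> ?gen (P ` set ks)"
  proof
    assume "R * P k \<in> ?gen (P ` set ks)"
    then have "R * P k * P k \<in> ?gen (P ` set (k # ks))"
      using generate.eng[of "R * P k" "pauli_group n" "P ` set (k # ks)" "P k"] mono
        generate.incl[of "P k" "P ` set (k # ks)" "pauli_group n"] by auto
    moreover have "R * P k * P k = R"
      using assoc_mult_mat[OF c(2) c(1) c(1)] c(2) abelian_pauli_subgroup_involution[OF A Pk]
      by (simp add: involution_def)
    ultimately show False using Cons.prems by simp
  qed
  have "mat_trace (R * (?J * \<rho>)) = 0"
    using Cons.prems mono by (intro Cons.IH) auto
  moreover have "mat_trace (R * P k * (?J * \<rho>)) = 0"
    using Cons.prems RP abelian_pauli_subgroup_mult[OF A] by (intro Cons.IH) auto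
  moreover have "R * (?E * ?J * \<rho>)
      = (1 / 2) \<cdot>\<^sub>m (R * (?J * \<rho>) + (- 1) ^ x k \<cdot>\<^sub>m (R * P k * (?J * \<rho>)))"
  proof -
    have "?E * ?J * \<rho> = (1 / 2) \<cdot>\<^sub>m (?J * \<rho> + (- 1) ^ x k \<cdot>\<^sub>m (P k * (?J * \<rho>)))"
      using assoc_mult_mat[OF eigenprojector_carrier[OF c(1)] J \<rho>]
      by (simp add: eigenprojector_mult(1)[OF c(1) J\<rho>])
    moreover have "R * ((1 / 2) \<cdot>\<^sub>m (?J * \<rho> + (- 1) ^ x k \<cdot>\<^sub>m (P k * (?J * \<rho>))))
        = (1 / 2) \<cdot>\<^sub>m (R * (?J * \<rho>) + (- 1) ^ x k \<cdot>\<^sub>m (R * (P k * (?J * \<rho>))))"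
      using J\<rho> PJ c mult_smult_distrib[OF c(2), of _ ?N "1 / 2"]
      by (simp add: mult_add_distrib_mat[OF c(2) J\<rho>] mult_smult_distrib[OF c(2) PJ])
    ultimately show ?thesis using assoc_mult_mat[OF c(2) c(1) J\<rho>] by simp
  qed
  ultimately show ?case
    using RJ by (simp add: mat_trace_smult[of _ ?N] mat_trace_add[of _ ?N])
qed

text \<open>Each factor contributes 1/2: by independence of \<open>P k\<close> from the remaining
  generators, the term that contains \<open>P k\<close> has trace zero.\<close>

lemma trace_independent_projector:
  assumes ks: "\<And>k. k \<in> set ks \<Longrightarrow> P k \<in> A" and d: "distinct ks"
    and ind: "\<And>k. k \<in> set ks \<Longrightarrow> P k \<notin> generate (pauli_group n) (P ` (set ks - {k}))"
    and \<rho>: "\<rho> \<in> carrier_mat (2 ^ n) (2 ^ n)" "mat_trace \<rho> = 1"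
    and zero: "\<And>Q. Q \<in> A \<Longrightarrow> Q \<noteq> 1\<^sub>m (2 ^ n) \<Longrightarrow> mat_trace (Q * \<rho>) = 0"
  shows "mat_trace (joint_projector (2 ^ n) P x ks * \<rho>) = 1 / 2 ^ length ks"
  using ks d ind
proof (induction ks)
  case Nil
  then show ?case using \<rho> by simp
next
  case (Cons k ks)
  let ?N = "2 ^ n :: nat" and ?gen = "generate (pauli_group n)"
  let ?J = "joint_projector ?N P x ks" and ?E = "eigenprojector ?N ((- 1) ^ x k) (P k)"
  have Pk: "P k \<in> A" using Cons.prems by simp
  note c = member_carrier[OF Pk]
  have J: "?J \<in> carrier_mat ?N ?N"
    using Cons.prems member_carrier by (intro joint_projector_carrier) auto
  have J\<rho>: "?J * \<rho> \<in> carrier_mat ?N ?N" "P k * (?J * \<rho>) \<in> carrier_mat ?N ?N"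
    using J \<rho> c by auto
  have "P j \<notin> ?gen (P ` (set ks - {j}))" if "j \<in> set ks" for j
    using Cons.prems(3)[of j] that
      group.mono_generate[OF group_pauli_group, of "P ` (set ks - {j})" "P ` (set (k # ks) - {j})" n]
    by fastforce
  then have IH: "mat_trace (?J * \<rho>) = 1 / 2 ^ length ks"
    using Cons.prems by (intro Cons.IH) auto
  have "set (k # ks) - {k} = set ks" using Cons.prems by auto
  then have "P k \<notin> ?gen (P ` set ks)" using Cons.prems(3)[of k] by simp
  then have "mat_trace (P k * (?J * \<rho>)) = 0"
    using Cons.prems by (intro trace_generated_projector_eq_0[OF _ Pk _ \<rho>(1) zero]) auto
  moreover have "?E * ?J * \<rho> = (1 / 2) \<cdot>\<^sub>m (?J * \<rho> + (- 1) ^ x k \<cdot>\<^sub>m (P k * (?J * \<rho>)))"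
    using assoc_mult_mat[OF eigenprojector_carrier[OF c] J \<rho>(1)]
    by (simp add: eigenprojector_mult(1)[OF c J\<rho>(1)])
  ultimately show ?case
    using J\<rho> IH by (simp add: mat_trace_smult[of _ ?N] mat_trace_add[of _ ?N])
qed

text \<open>Reduces unbiasedness to expectation values: in the expansion of a projector in the
  generators only the identity term has nonzero trace against \<rho>.\<close>

lemma unbiasedI:
  assumes \<rho>: "density_operator n \<rho>"
    and zero: "\<And>Q. Q \<in> A \<Longrightarrow> Q \<noteq> 1\<^sub>m (2 ^ n) \<Longrightarrow> mat_trace (Q * \<rho>) = 0"
  shows "unbiased n A \<rho>"
proof -
  let ?gs = "generators n A" and ?m = "pauli_dim n A"
  have ind: "distinct ?gs" "\<And>P. P \<in> set ?gs \<Longrightarrow> P \<notin> generate (pauli_group n) (set ?gs - {P})"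
    using independent_generators_generators by (auto simp: independent_generators_def)
  have "?gs ! k \<notin> generate (pauli_group n) ((!) ?gs ` (set [0..<?m] - {k}))" if "k < ?m" for k
  proof -
    \<comment> \<open>Distinctness turns the independence of a set of generators into that of an
      indexed family.\<close>
    have "(!) ?gs ` (set [0..<?m] - {k}) \<subseteq> set ?gs - {?gs ! k}"
      using that ind(1) by (auto simp: pauli_dim_def nth_eq_iff_index_eq)
    then show ?thesis
      using ind(2)[of "?gs ! k"] that group.mono_generate[OF group_pauli_group]
      by (metis nth_mem pauli_dim_def subsetD)
  qed
  then have "mat_trace (projector n A x * \<rho>) = 1 / 2 ^ length [0..<?m]" for x
    unfolding projector_eq_joint_projector using \<rho> generator_mem
    by (intro trace_independent_projector[OF _ _ _ _ _ zero]) (auto simp: density_operator_def)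
  then show ?thesis by (simp add: unbiased_def outcome_prob_def)
qed

section \<open>Generators have definite values in states of maximal information\<close>

text \<open>The joint projector of the certain outcome lies below the eigenprojector of the
  generator with the same sign. That eigenprojector then has expectation one as well, which leaves
  zero for the opposite sign.\<close>

lemma maximal_information_generator:
  assumes \<rho>: "density_operator n \<rho>" "maximal_information n A \<rho>" and k: "k < pauli_dim n A"
  shows "\<exists>s\<in>{1, - 1}. mat_trace (eigenprojector (2 ^ n) s (generators n A ! k) * \<rho>) = 0"
proof -
  let ?N = "2 ^ n :: nat" and ?P = "generators n A ! k"
  obtain x where x: "mat_trace (projector n A x * \<rho>) = 1"
    using \<rho>(2) by (auto simp: maximal_information_def outcome_prob_def)
  let ?J = "projector n A x"
  \<comment> \<open>\<open>s\<close> is the value that the generator takes in the certain outcome;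
    the witness for the claim is \<open>- s\<close>.\<close>
  define s :: complex where "s = (- 1) ^ x k"
  have s: "s \<in> {1, - 1}" "- s \<in> {1, - 1}" "s * s = 1"
    using neg_one_power_cases[of "x k"] by (auto simp: s_def)
  let ?E = "eigenprojector ?N s ?P" and ?F = "eigenprojector ?N (- s) ?P"
  have P: "?P \<in> A" "involution ?N ?P" "?P \<in> carrier_mat ?N ?N"
    using generator_mem[OF k] abelian_pauli_subgroup_involution[OF A] member_carrier by auto
  have E: "orth_projector ?N ?E" and F: "orth_projector ?N ?F"
    using orth_projector_eigenprojector[OF P(2)] s by auto
  have J: "orth_projector ?N ?J" by (rule orth_projector_projector)
  have c: "?E \<in> carrier_mat ?N ?N" "?F \<in> carrier_mat ?N ?N" "?J \<in> carrier_mat ?N ?N"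
    "\<rho> \<in> carrier_mat ?N ?N" "mat_trace \<rho> = 1"
    using E F J \<rho> by (auto simp: orth_projector_def density_operator_def)
  have "?P * ?J = s \<cdot>\<^sub>m ?J" using generator_mult_projector[OF k] by (simp add: s_def)
  then have "?E * ?J = (1 / 2) \<cdot>\<^sub>m (?J + ?J)"
    by (simp add: eigenprojector_mult(1)[OF P(3) c(3)] smult_smult_mat s smult_one)
  also have "\<dots> = ?J" using c by (intro eq_matI) auto
  finally have EJ: "?E * ?J = ?J" .
  then have JE: "?J * ?E = ?J"
    using mat_adjoint_mult[OF c(1) c(3)] E J by (simp add: orth_projector_def)
  \<comment> \<open>This difference is the projector onto the part of the eigenspace orthogonal to
    the range of \<open>?J\<close>.\<close>
  let ?D = "?E + (- 1) \<cdot>\<^sub>m ?J"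
  have mJ: "(- 1) \<cdot>\<^sub>m ?J \<in> carrier_mat ?N ?N" using c by simp
  have D: "orth_projector ?N ?D"
  proof -
    have Dc: "?D \<in> carrier_mat ?N ?N" using c mJ by simp
    have "?D * ?E = ?D"
      using add_mult_distrib_mat[OF c(1) mJ c(1)] mult_smult_assoc_mat[OF c(3) c(1)] E JE
      by (simp add: orth_projector_def)
    moreover have "?D * ?J = ?J + (- 1) \<cdot>\<^sub>m ?J"
      using add_mult_distrib_mat[OF c(1) mJ c(3)] mult_smult_assoc_mat[OF c(3) c(3)] J EJ
      by (simp add: orth_projector_def)
    ultimately have "?D * ?D = ?D + (- 1) \<cdot>\<^sub>m (?J + (- 1) \<cdot>\<^sub>m ?J)"
      using mult_add_distrib_mat[OF Dc c(1) mJ] mult_smult_distrib[OF Dc c(3)] by simp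
    also have "\<dots> = ?D"
      using c(1,3) by (intro eq_matI) auto
    finally show ?thesis
      using mat_adjoint_add[OF c(1) mJ] mat_adjoint_smult[OF c(3)] E J c(1) mJ
      by (simp add: orth_projector_def)
  qed
  \<comment> \<open>Nonnegativity of the expectation of \<open>?D\<close> compares \<open>?E\<close>
    with \<open>?J\<close>, whose expectation is 1.\<close>
  have tE: "Re (mat_trace (?E * \<rho>)) \<ge> 1"
  proof -
    have "?D * \<rho> = ?E * \<rho> + (- 1) \<cdot>\<^sub>m (?J * \<rho>)"
      using add_mult_distrib_mat[OF c(1) mJ c(4)] mult_smult_assoc_mat[OF c(3) c(4)] by simp
    then have "mat_trace (?D * \<rho>) = mat_trace (?E * \<rho>) - 1"
      using c x by (simp add: mat_trace_add[of _ ?N] mat_trace_smult[of _ ?N])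
    then show ?thesis using orth_projector_expectation_nonneg[OF \<rho>(1) D] by simp
  qed
  have "?E * \<rho> + ?F * \<rho> = \<rho>"
    unfolding eigenprojector_mult(1)[OF P(3) c(4)]
    using P(3) c(4) by (intro eq_matI) (auto simp: field_simps simp del: index_mult_mat(1))
  then have sum: "mat_trace (?E * \<rho>) + mat_trace (?F * \<rho>) = 1"
    using c mat_trace_add[of "?E * \<rho>" ?N "?F * \<rho>"] by simp
  have "Re (mat_trace (?F * \<rho>)) = 0"
    using tE orth_projector_expectation_nonneg[OF \<rho>(1) F] arg_cong[OF sum, of Re] by simp
  moreover have "Im (mat_trace (?F * \<rho>)) = 0"
    using F by (intro density_operator_expectation_real[OF \<rho>(1)]) (auto simp: orth_projector_def)
  ultimately have "mat_trace (?F * \<rho>) = 0" by (simp add: complex_eq_iff)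
  then show ?thesis using s(2) by blast
qed

text \<open>The matrices that commute with \<open>Q\<close> are closed under products. In
  contrapositive form: if some member of \<open>A\<close> fails to commute with \<open>Q\<close>, so
  does some generator.\<close>

lemma generators_commute:
  assumes Q: "Q \<in> carrier_mat (2 ^ n) (2 ^ n)"
    and comm: "\<And>P. P \<in> set (generators n A) \<Longrightarrow> P * Q = Q * P" and R: "R \<in> A"
  shows "R * Q = Q * R"
proof -
  have "R \<in> generate (pauli_group n) (set (generators n A))" using R generate_generators by simp
  from A generators_subset this have "R \<in> A \<and> R * Q = Q * R"
  proof (induction rule: generate_abelian_induct)
    case one
    then show ?case using Q by simp
  next
    case (incl P)
    then show ?case by (rule comm)
  next
    case (mult P P')
    note c = member_carrier[OF mult(1)] member_carrier[OF mult(2)]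
    have "P * P' * Q = P * (Q * P')" using assoc_mult_mat[OF c Q] mult by simp
    also have "\<dots> = Q * P * P'" using assoc_mult_mat[OF c(1) Q c(2)] mult by simp
    also have "\<dots> = Q * (P * P')" by (rule assoc_mult_mat[OF Q c])
    finally show ?case .
  qed
  then show ?thesis by blast
qed

end

section \<open>Complementarity\<close>

text \<open>Each \<open>Q\<close> in \<open>B\<close> other than the identity anticommutes with a
  generator of \<open>A\<close>. That generator has a definite value in \<rho>, which forces the
  expectation of \<open>Q\<close> to vanish.\<close>

lemma unbiased_if_anticommuting_generator:
  assumes A: "abelian_pauli_subgroup n A" and B: "abelian_pauli_subgroup n B"
    and triv: "unsigned_paulis n B \<inter> commutant n A = {1\<^sub>m (2 ^ n)}"
    and \<rho>: "density_operator n \<rho>" "maximal_information n A \<rho>"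
  shows "unbiased n B \<rho>"
proof (rule unbiasedI[OF B \<rho>(1)])
  let ?N = "2 ^ n :: nat"
  fix Q assume Q: "Q \<in> B" "Q \<noteq> 1\<^sub>m ?N"
  have iQ: "Q \<in> carrier_mat ?N ?N" "mat_adjoint Q = Q" "Q * Q = 1\<^sub>m ?N"
    using abelian_pauli_subgroup_involution[OF B Q(1)] by (auto simp: involution_def)
  have mB: "- 1\<^sub>m ?N \<notin> B" using B by (simp add: abelian_pauli_subgroup_def)
  have "\<not> (\<forall>P\<in>A. P * Q = Q * P)"
  proof
    assume comm: "\<forall>P\<in>A. P * Q = Q * P"
    \<comment> \<open>The commutant contains only unsigned Pauli operators, so \<open>Q\<close> is
      replaced by its unsigned version. If that were the identity, \<open>Q\<close> would be 1 or
      -1, and -1 is not in \<open>B\<close>.\<close>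
    obtain Q' where Q': "Q' \<in> pauli_ops n" "Q' = Q \<or> Q' = - Q"
      using abelian_pauli_subgroup_cases[OF B Q(1)] by blast
    have "Q' * P = P * Q'" if "P \<in> A" for P
      using Q'(2) comm that iQ(1) member_carrier[OF A that] by auto
    then have "Q' \<in> commutant n A" using Q'(1) by (simp add: commutant_def)
    moreover have "Q' \<in> unsigned_paulis n B"
      using Q' Q(1) uminus_uminus_mat[of Q] by (auto simp: unsigned_paulis_def)
    ultimately have "Q' = 1\<^sub>m ?N" using triv by blast
    then show False using Q' Q mB uminus_uminus_mat[of Q] by auto
  qed
  then obtain P where P: "P \<in> set (generators n A)" "P * Q \<noteq> Q * P"
    using generators_commute[OF A iQ(1)] by blast
  then obtain k where k: "k < pauli_dim n A" "P = generators n A ! k"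
    by (auto simp: in_set_conv_nth pauli_dim_def)
  have PA: "P \<in> A" using generator_mem[OF A k(1)] k(2) by simp
  note Pc = member_carrier[OF A PA]
  have anti: "P * Q = - (Q * P)"
    using abelian_pauli_subgroup_commute_cases[OF A PA B Q(1)] P(2) by blast
  obtain s where s: "s \<in> {1, - 1}" "mat_trace (eigenprojector ?N s P * \<rho>) = 0"
    using maximal_information_generator[OF A \<rho> k(1)] k(2) by blast
  let ?W = "eigenprojector ?N s P"
  have QP: "Q * P \<in> carrier_mat ?N ?N" using iQ Pc by simp
  \<comment> \<open>The two terms in \<open>Q * P\<close> cancel by anticommutation, and the two
    halves of \<open>Q\<close> remain.\<close>
  have "?W * Q + Q * ?W = (1 / 2) \<cdot>\<^sub>m (Q + s \<cdot>\<^sub>m - (Q * P)) + (1 / 2) \<cdot>\<^sub>m (Q + s \<cdot>\<^sub>m (Q * P))"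
    by (simp add: eigenprojector_mult[OF Pc iQ(1)] anti)
  also have "\<dots> = Q"
    using iQ(1) QP by (intro eq_matI) (auto simp: field_simps simp del: index_mult_mat(1))
  finally show "mat_trace (Q * \<rho>) = 0"
    by (rule expectation_eq_0[OF \<rho>(1)
          orth_projector_eigenprojector[OF abelian_pauli_subgroup_involution[OF A PA] s(1)] s(2) iQ])
qed

section \<open>Complementarity implies trivial intersections\<close>

text \<open>If 1 + sP vanishes, then P = -s, because \<open>s\<close> is its own inverse.\<close>

lemma eigenprojector_nonzero:
  assumes P: "P \<in> carrier_mat N N" and s: "s \<in> {1, - 1}" and neq: "P \<noteq> (- s) \<cdot>\<^sub>m 1\<^sub>m N"
  shows "eigenprojector N s P \<noteq> 0\<^sub>m N N"
proof
  assume 0: "eigenprojector N s P = 0\<^sub>m N N"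
  have "P $$ (i, j) = ((- s) \<cdot>\<^sub>m 1\<^sub>m N) $$ (i, j)" if "i < N" "j < N" for i j
    using arg_cong[OF 0, of "\<lambda>M. M $$ (i, j)"] that P s
    by (auto simp: eigenprojector_def add_eq_0_iff split: if_splits)
  then have "P = (- s) \<cdot>\<^sub>m 1\<^sub>m N" using P by (intro eq_matI) auto
  then show False using neq by simp
qed

text \<open>The state proportional to \<open>\<Pi>\<^sub>x\<^sup>B (1 + P)\<close>, for a suitable outcome \<open>x\<close>, has maximal
  information in \<open>B\<close>, and it satisfies \<open>P \<rho> = \<rho>\<close>. Outcomes in \<open>A\<close> for which \<open>P\<close> has
  eigenvalue \<open>- 1\<close> therefore have probability zero.\<close>

lemma complementary_imp_commuting_trivial:
  assumes A: "abelian_pauli_subgroup n A" and B: "abelian_pauli_subgroup n B"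
    and P: "P \<in> A" and comm: "\<And>Q. Q \<in> B \<Longrightarrow> Q * P = P * Q"
    and unb: "\<And>\<rho>. density_operator n \<rho> \<Longrightarrow> maximal_information n B \<rho> \<Longrightarrow> unbiased n A \<rho>"
  shows "P = 1\<^sub>m (2 ^ n)"
proof (rule ccontr)
  assume P1: "P \<noteq> 1\<^sub>m (2 ^ n)"
  let ?N = "2 ^ n :: nat"
  let ?M = "eigenprojector ?N 1 P" and ?M' = "eigenprojector ?N (- 1) P"
  note Pc = member_carrier[OF A P] and iP = abelian_pauli_subgroup_involution[OF A P]
  have M: "orth_projector ?N ?M" using orth_projector_eigenprojector[OF iP] by simp
  have c: "?M \<in> carrier_mat ?N ?N" "?M' \<in> carrier_mat ?N ?N" using Pc by auto
  have "P \<noteq> - 1\<^sub>m ?N" using A P by (auto simp: abelian_pauli_subgroup_def)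
  then have "?M \<noteq> 0\<^sub>m ?N ?N"
    using eigenprojector_nonzero[OF Pc, of 1] by (simp add: uminus_eq_smult)
  then obtain x where x: "x \<in> bit_vectors (pauli_dim n B)" "projector n B x * ?M \<noteq> 0\<^sub>m ?N ?N"
    using projector_nonzero[OF B c(1)] by blast
  let ?X = "projector n B x" and ?T = "projector n B x * ?M"
  note Xc = projector_carrier[OF B, of x]
  have Tc: "?T \<in> carrier_mat ?N ?N" using Xc c by simp
  have XP: "?X * P = P * ?X" by (rule projector_commute[OF B Pc comm])
  then have XM: "?X * ?M = ?M * ?X" using eigenprojector_commute[OF Pc Xc] by simp
  have T: "orth_projector ?N ?T"
    by (rule orth_projector_mult[OF orth_projector_projector[OF B] M XM])
  obtain t where t: "0 < t" "mat_trace ?T = complex_of_real t"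
    using mat_trace_orth_projector_pos[OF T x(2)] .
  define \<rho> where "\<rho> = (1 / mat_trace ?T) \<cdot>\<^sub>m ?T"
  have \<rho>: "density_operator n \<rho>"
    unfolding \<rho>_def by (rule density_operator_of_projector[OF T x(2)])
  then have \<rho>c: "\<rho> \<in> carrier_mat ?N ?N" by (simp add: density_operator_def)
  have "maximal_information n B \<rho>"
    unfolding maximal_information_def outcome_prob_def
  proof (intro bexI[OF _ x(1)] ballI)
    fix y assume y: "y \<in> bit_vectors (pauli_dim n B)"
    note Yc = projector_carrier[OF B, of y]
    have "projector n B y * \<rho> = (1 / mat_trace ?T) \<cdot>\<^sub>m (projector n B y * ?X * ?M)"
      unfolding \<rho>_def using mult_smult_distrib[OF Yc Tc] assoc_mult_mat[OF Yc Xc c(1)] by simp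
    \<comment> \<open>Orthogonality excludes every outcome of \<open>B\<close> other than
      \<open>x\<close>; idempotence gives the remaining one probability 1.\<close>
    moreover have "projector n B y * ?X = (if y = x then ?X else 0\<^sub>m ?N ?N)"
      using projector_orthogonal[OF B x(1) y] orth_projector_projector[OF B, of x]
      by (auto simp: orth_projector_def)
    moreover have "mat_trace (0\<^sub>m ?N ?N) = 0" by (simp add: mat_trace_def)
    ultimately show "mat_trace (projector n B y * \<rho>) = (if y = x then 1 else 0)"
      using t c Tc by (simp add: mat_trace_smult[of _ ?N])
  qed
  then have unbA: "unbiased n A \<rho>" by (rule unb[OF \<rho>])
  \<comment> \<open>\<open>P\<close> commutes with \<open>?X\<close> and so reaches its own
    eigenprojector \<open>?M\<close>, which absorbs it with eigenvalue 1.\<close>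
  have "P * ?T = ?X * (P * ?M)"
    using assoc_mult_mat[OF Pc Xc c(1)] assoc_mult_mat[OF Xc Pc c(1)] XP by simp
  also have "\<dots> = ?T" using mult_eigenprojector[OF iP, of 1] by (simp add: smult_one)
  finally have P\<rho>: "P * \<rho> = \<rho>" unfolding \<rho>_def using mult_smult_distrib[OF Pc Tc] by simp
  \<comment> \<open>As \<open>P\<close> is not the identity, it has eigenvalue -1; some outcome
    \<open>y\<close> of \<open>A\<close> then meets that eigenspace.\<close>
  have "?M' \<noteq> 0\<^sub>m ?N ?N"
    using eigenprojector_nonzero[OF Pc, of "- 1"] P1 by (simp add: smult_one)
  then obtain y where y: "y \<in> bit_vectors (pauli_dim n A)" "projector n A y * ?M' \<noteq> 0\<^sub>m ?N ?N"
    using projector_nonzero[OF A c(2)] by blast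
  let ?Y = "projector n A y"
  note Yc = projector_carrier[OF A, of y]
  have YP: "?Y * P = P * ?Y" by (rule projector_commute[OF A Pc member_commute[OF A _ P]])
  obtain e where e: "e \<in> {1, - 1}" "P * ?Y = e \<cdot>\<^sub>m ?Y"
    using member_mult_projector[OF A P] by blast
  \<comment> \<open>If \<open>P\<close> took the value 1 in the outcome \<open>y\<close>, then
    \<open>?Y\<close> would annihilate the eigenspace for -1.\<close>
  have "e \<noteq> 1"
  proof
    assume "e = 1"
    then have "?Y * ?M' = (1 / 2) \<cdot>\<^sub>m (?Y + (- 1) \<cdot>\<^sub>m ?Y)"
      using e(2) by (simp add: eigenprojector_mult(2)[OF Pc Yc] YP smult_one)
    also have "\<dots> = 0\<^sub>m ?N ?N" using Yc by (intro eq_matI) auto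
    finally show False using y(2) by simp
  qed
  then have YPm: "?Y * P = (- 1) \<cdot>\<^sub>m ?Y" using e YP by auto
  \<comment> \<open>Inserting \<open>P\<close> between the two leaves the product unchanged through
    \<rho> and negates it through \<open>?Y\<close>.\<close>
  have "?Y * \<rho> = ?Y * P * \<rho>" using assoc_mult_mat[OF Yc Pc \<rho>c] P\<rho> by simp
  also have "\<dots> = (- 1) \<cdot>\<^sub>m (?Y * \<rho>)" unfolding YPm by (rule mult_smult_assoc_mat[OF Yc \<rho>c])
  finally have "mat_trace (?Y * \<rho>) = - mat_trace (?Y * \<rho>)"
    using mat_trace_smult[OF mult_carrier_mat[OF Yc \<rho>c], of "- 1"] by simp
  then have "mat_trace (?Y * \<rho>) = 0" by simp
  then show False using unbA y(1) by (auto simp: unbiased_def outcome_prob_def)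
qed

lemma one_in_unsigned_paulis:
  "abelian_pauli_subgroup n A \<Longrightarrow> 1\<^sub>m (2 ^ n) \<in> unsigned_paulis n A"
  using one_in_pauli_ops abelian_pauli_subgroup_one by (auto simp: unsigned_paulis_def)

lemma one_in_commutant:
  assumes "abelian_pauli_subgroup n A"
  shows "1\<^sub>m (2 ^ n) \<in> commutant n A"
  using one_in_pauli_ops left_mult_one_mat[OF member_carrier[OF assms]]
    right_mult_one_mat[OF member_carrier[OF assms]] by (simp add: commutant_def)

text \<open>Either \<open>P\<close> or \<open>- P\<close> belongs to \<open>A\<close>, and that one
  must be the identity. The second case is impossible, since -1 is not among the unsigned Pauli
  operators.\<close>

lemma complementary_imp_trivial_intersection:
  assumes A: "abelian_pauli_subgroup n A" and B: "abelian_pauli_subgroup n B"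
    and unb: "\<And>\<rho>. density_operator n \<rho> \<Longrightarrow> maximal_information n B \<rho> \<Longrightarrow> unbiased n A \<rho>"
  shows "unsigned_paulis n A \<inter> commutant n B = {1\<^sub>m (2 ^ n)}"
proof -
  have "P = 1\<^sub>m (2 ^ n)" if P: "P \<in> unsigned_paulis n A" "P \<in> commutant n B" for P
  proof -
    have ops: "P \<in> pauli_ops n" and mem: "P \<in> A \<or> - P \<in> A"
      and comm: "\<And>Q. Q \<in> B \<Longrightarrow> Q * P = P * Q"
      using P by (auto simp: unsigned_paulis_def commutant_def)
    have comm': "Q * - P = - P * Q" if "Q \<in> B" for Q
      using comm[OF that] pauli_ops_carrier[OF ops] member_carrier[OF B that] by simp
    show ?thesis
      using mem
    proof
      assume "P \<in> A"
      then show ?thesis by (rule complementary_imp_commuting_trivial[OF A B _ comm unb])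
    next
      assume "- P \<in> A"
      then have "- P = 1\<^sub>m (2 ^ n)"
        by (rule complementary_imp_commuting_trivial[OF A B _ comm' unb])
      then have "P = - 1\<^sub>m (2 ^ n)" using uminus_uminus_mat[of P] by simp
      then show ?thesis using ops neg_one_notin_pauli_ops by simp
    qed
  qed
  then show ?thesis using one_in_unsigned_paulis[OF A] one_in_commutant[OF B] by blast
qed

theorem theorem1:
  fixes n :: nat and A B :: "complex mat set"
  assumes "n \<ge> 1"
    and "abelian_pauli_subgroup n A"
    and "abelian_pauli_subgroup n B"
  shows "complementary n A B \<longleftrightarrow>
    unsigned_paulis n A \<inter> commutant n B = {1\<^sub>m (2 ^ n)} \<and>
    unsigned_paulis n B \<inter> commutant n A = {1\<^sub>m (2 ^ n)}"
proof
  assume "complementary n A B"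
  then show "unsigned_paulis n A \<inter> commutant n B = {1\<^sub>m (2 ^ n)} \<and>
      unsigned_paulis n B \<inter> commutant n A = {1\<^sub>m (2 ^ n)}"
    using complementary_imp_trivial_intersection[OF assms(2,3)]
      complementary_imp_trivial_intersection[OF assms(3,2)]
    unfolding complementary_def by blast
next
  assume "unsigned_paulis n A \<inter> commutant n B = {1\<^sub>m (2 ^ n)} \<and>
    unsigned_paulis n B \<inter> commutant n A = {1\<^sub>m (2 ^ n)}"
  then show "complementary n A B"
    using unbiased_if_anticommuting_generator[OF assms(2,3)]
      unbiased_if_anticommuting_generator[OF assms(3,2)]
    unfolding complementary_def by blast
qed

end
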